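(* Let $l\ge 2$ and $d_1,\ldots,d_l\ge 2$ be integers. The following statements hold: 1. Let $Q_i\subset\mathbb{R}^{d_i}$, $i=1,\ldots,l$, be $0$-symmetric convex bodies. Then $\mathcal{B}_{Q_{1},\ldots,Q_{l}}(\otimes_{i=1}^{l}\mathbb{R}^{d_{i}})$ is a compact convex subset of the space of $0$-symmetric convex bodies in $\otimes_{i=1}^{l}\mathbb{R}^{d_{i}}$. 2. $\mathcal{B}_{\otimes}(\otimes_{i=1}^{l}\mathbb{R}^{d_{i}})$ is closed in the space of $0$-symmetric convex bodies in $\otimes_{i=1}^{l}\mathbb{R}^{d_{i}}$.
   Context: $\otimes_{i=1}^l\mathbb{R}^{d_i}$ is a Euclidean space with the scalar product $\langle\cdot,\cdot\rangle_H$ determined by $\langle x^1\otimes\cdots\otimes x^l,y^1\otimes\cdots\otimes y^l\rangle_H=\prod_{i=1}^l\langle x^i,y^i\rangle$. A $0$-symmetric convex body in a finite-dimensional Euclidean space $\mathbb{E}$ is a compact convex set $Q\subset\mathbb{E}$ with nonempty interior and $Q=-Q$. Its polar is $Q^\circ=\{y\in\mathbb{E}:\sup_{x\in Q}|\langle x,y\rangle|\le 1\}$. The space of $0$-symmetric convex bodies carries the topology of the Hausdorff distance $\delta^H(P,Q)=\min\{\lambda\ge0: P\subseteq Q+\lambda B_{\mathbb{E}},\ Q\subseteq P+\lambda B_{\mathbb{E}}\}$, with $B_{\mathbb{E}}$ the closed unit ball. Convexity of a set of convex bodies is understood with respect to Minkowski combinations $tQ+(1-t)P$, $0\le t\le1$.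 For $0$-symmetric convex bodies $Q_i\subset\mathbb{R}^{d_i}$: $Q_1\otimes_\pi\cdots\otimes_\pi Q_l:=\mathrm{conv}\{x^1\otimes\cdots\otimes x^l: x^i\in Q_i\}$ and $Q_1\otimes_\epsilon\cdots\otimes_\epsilon Q_l:=(Q_1^\circ\otimes_\pi\cdots\otimes_\pi Q_l^\circ)^\circ$. A $0$-symmetric convex body $Q\subset\otimes_{i=1}^l\mathbb{R}^{d_i}$ is a tensorial body with respect to $Q_1,\ldots,Q_l$ if $Q_1\otimes_\pi\cdots\otimes_\pi Q_l\subseteq Q\subseteq Q_1\otimes_\epsilon\cdots\otimes_\epsilon Q_l$; the set of these is $\mathcal{B}_{Q_1,\ldots,Q_l}(\otimes_{i=1}^l\mathbb{R}^{d_i})$. $Q$ is a tensorial body if it is a tensorial body with respect to some $0$-symmetric convex bodies $Q_i\subset\mathbb{R}^{d_i}$; the set of tensorial bodies is $\mathcal{B}_\otimes(\otimes_{i=1}^l\mathbb{R}^{d_i})$. *)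

theory Defs
  imports "HOL-Analysis.Analysis"
begin

subsection \<open>Convex bodies in a subspace of a Euclidean space\<close>

text \<open>
  The dimensions \<open>d\<^sub>i\<close> of the factors vary, so the space \<open>\<real>\<^sup>d\<close> is represented as a coordinate
  subspace of a type \<open>real ^ 'n\<close>. The notions below are therefore relative to a linear
  subspace \<open>E\<close> of a Euclidean space, with the inner product inherited from that space.
  In particular, interiors, polars and unit balls are taken inside \<open>E\<close>.
\<close>

definition sym_convex_bodies :: "'a::euclidean_space set \<Rightarrow> 'a set set" where
  "sym_convex_bodies E =
     {Q. Q \<subseteq> E \<and> compact Q \<and> convex Q \<and> (top_of_set E) interior_of Q \<noteq> {} \<and> Q = uminus ` Q}"

text \<open>The supremum is taken in \<^typ>\<open>ereal\<close>, so that it is also meaningful for unbounded \<open>Q\<close>.\<close>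

definition polar_in :: "'a::euclidean_space set \<Rightarrow> 'a set \<Rightarrow> 'a set" where
  "polar_in E Q = {y \<in> E. (SUP x\<in>Q. ereal \<bar>x \<bullet> y\<bar>) \<le> 1}"

definition hausdorff_radii :: "'a::euclidean_space set \<Rightarrow> 'a set \<Rightarrow> 'a set \<Rightarrow> real set" where
  "hausdorff_radii E P Q =
     {r. 0 \<le> r \<and> P \<subseteq> Q + (*\<^sub>R) r ` (cball 0 1 \<inter> E) \<and> Q \<subseteq> P + (*\<^sub>R) r ` (cball 0 1 \<inter> E)}"

text \<open>
  For compact \<open>P\<close>, \<open>Q\<close> the infimum is a minimum. The value \<open>0\<close> for pairs of sets without any
  admissible radius never occurs on convex bodies; it only makes the function nonnegative
  everywhere, as the locale \<^locale>\<open>Metric_space\<close> requires.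
\<close>

definition hausdorff_dist :: "'a::euclidean_space set \<Rightarrow> 'a set \<Rightarrow> 'a set \<Rightarrow> real" where
  "hausdorff_dist E P Q =
     (if hausdorff_radii E P Q = {} then 0 else Inf (hausdorff_radii E P Q))"

definition hausdorff_topology :: "'a::euclidean_space set \<Rightarrow> 'a set topology" where
  "hausdorff_topology E = Metric_space.mtopology (sym_convex_bodies E) (hausdorff_dist E)"

definition minkowski_convex :: "'a::real_vector set set \<Rightarrow> bool" where
  "minkowski_convex \<B> \<longleftrightarrow>
     (\<forall>Q\<in>\<B>. \<forall>P\<in>\<B>. \<forall>t\<in>{0..1}. (*\<^sub>R) t ` Q + (*\<^sub>R) (1 - t) ` P \<in> \<B>)"

lemma hausdorff_radii_commute: "hausdorff_radii E P Q = hausdorff_radii E Q P"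
  by (auto simp: hausdorff_radii_def)

lemma sym_convex_bodies_nonempty: "Q \<in> sym_convex_bodies E \<Longrightarrow> Q \<noteq> {}"
  by (auto simp: sym_convex_bodies_def)

lemma hausdorff_inclusion_iff:
  fixes E :: "'a::euclidean_space set"
  assumes "subspace E" "P \<subseteq> E" "Q \<subseteq> E" "0 \<le> r"
  shows "P \<subseteq> Q + (*\<^sub>R) r ` (cball 0 1 \<inter> E) \<longleftrightarrow> (\<forall>p\<in>P. \<exists>q\<in>Q. dist p q \<le> r)"
proof
  assume L: "P \<subseteq> Q + (*\<^sub>R) r ` (cball 0 1 \<inter> E)"
  show "\<forall>p\<in>P. \<exists>q\<in>Q. dist p q \<le> r"
  proof
    fix p assume "p \<in> P"
    then obtain q b where "q \<in> Q" "b \<in> cball 0 1" "p = q + r *\<^sub>R b"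
      using L unfolding set_plus_def by blast
    then have "dist p q = r * norm b" "norm b \<le> 1" using \<open>0 \<le> r\<close> by (simp_all add: dist_norm)
    then have "dist p q \<le> r" using \<open>0 \<le> r\<close> by (simp add: mult_left_le)
    then show "\<exists>q\<in>Q. dist p q \<le> r" using \<open>q \<in> Q\<close> by blast
  qed
next
  assume R: "\<forall>p\<in>P. \<exists>q\<in>Q. dist p q \<le> r"
  show "P \<subseteq> Q + (*\<^sub>R) r ` (cball 0 1 \<inter> E)"
  proof
    fix p assume p: "p \<in> P"
    then obtain q where q: "q \<in> Q" "dist p q \<le> r" using R by blast
    define b where "b = (1 / r) *\<^sub>R (p - q)"
    have "b \<in> E" unfolding b_def using assms p q by (meson subsetD subspace_diff subspace_scale)
    moreover have "norm b \<le> 1" using q \<open>0 \<le> r\<close> by (cases "r = 0") (auto simp: b_def dist_norm)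
    moreover have "p = q + r *\<^sub>R b" using q by (cases "r = 0") (auto simp: b_def)
    ultimately have "r *\<^sub>R b \<in> (*\<^sub>R) r ` (cball 0 1 \<inter> E)" "p = q + r *\<^sub>R b"
      by auto
    then show "p \<in> Q + (*\<^sub>R) r ` (cball 0 1 \<inter> E)"
      using q(1) by (simp add: set_plus_intro)
  qed
qed

lemma Metric_space_hausdorff_dist:
  assumes E: "subspace E"
  shows "Metric_space (sym_convex_bodies E) (hausdorff_dist E)"
proof -
  let ?M = "sym_convex_bodies E" and ?F = "hausdorff_radii E"
  have bdd: "bdd_below (?F P Q)" for P Q
    by (rule bdd_belowI[of _ 0]) (simp add: hausdorff_radii_def)
  have F: "r \<in> ?F P Q \<longleftrightarrow> 0 \<le> r \<and> (\<forall>p\<in>P. \<exists>q\<in>Q. dist p q \<le> r) \<and> (\<forall>q\<in>Q. \<exists>p\<in>P. dist q p \<le> r)"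
    if "P \<in> ?M" "Q \<in> ?M" for P Q r
  proof -
    have "P \<subseteq> E" "Q \<subseteq> E" using that by (simp_all add: sym_convex_bodies_def)
    then show ?thesis
      unfolding hausdorff_radii_def mem_Collect_eq
      using hausdorff_inclusion_iff[OF E, of P Q r] hausdorff_inclusion_iff[OF E, of Q P r]
      by (cases "0 \<le> r") (simp_all only: simp_thms)
  qed
  have ne: "?F P Q \<noteq> {}" if PQ: "P \<in> ?M" "Q \<in> ?M" for P Q
  proof -
    have "bounded P" "bounded Q"
      using PQ by (auto simp: sym_convex_bodies_def compact_imp_bounded)
    then have "bounded (P \<union> Q)" by simp
    then obtain r where r: "\<forall>x\<in>P \<union> Q. \<forall>y\<in>P \<union> Q. dist x y \<le> r"
      unfolding bounded_two_points by blast
    obtain p q where pq: "p \<in> P" "q \<in> Q"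
      using PQ sym_convex_bodies_nonempty by blast
    have "dist p q \<le> r" using r pq by blast
    then have "0 \<le> r" using zero_le_dist[of p q] by linarith
    then have "r \<in> ?F P Q" using r pq unfolding F[OF PQ] by blast
    then show ?thesis by blast
  qed
  have nonneg: "0 \<le> hausdorff_dist E P Q" for P Q
    by (auto simp: hausdorff_dist_def hausdorff_radii_def intro!: cInf_greatest)
  have approx: "\<exists>r\<in>?F P Q. r < hausdorff_dist E P Q + e"
    if "P \<in> ?M" "Q \<in> ?M" "0 < e" for P Q e
  proof (rule cInf_lessD[OF ne[OF that(1,2)]])
    show "Inf (?F P Q) < hausdorff_dist E P Q + e"
      unfolding hausdorff_dist_def using ne[OF that(1,2)] that(3) by simp
  qed
  have upper: "hausdorff_dist E P Q \<le> r" if "r \<in> ?F P Q" for P Q r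
    using that cInf_lower[OF _ bdd] by (auto simp: hausdorff_dist_def)
  have sub: "P \<subseteq> Q" if PQ: "P \<in> ?M" "Q \<in> ?M" and 0: "hausdorff_dist E P Q = 0" for P Q
  proof
    fix p assume p: "p \<in> P"
    have "\<exists>q\<in>Q. dist q p < e" if e: "0 < e" for e
    proof -
      obtain r where "r \<in> ?F P Q" "r < e" using approx[OF PQ e] 0 by auto
      then obtain q where "q \<in> Q" "dist p q \<le> r" using p unfolding F[OF PQ] by blast
      then have "dist q p < e" using \<open>r < e\<close> by (simp add: dist_commute)
      then show ?thesis using \<open>q \<in> Q\<close> by blast
    qed
    then have "p \<in> closure Q" by (simp add: closure_approachable)
    then show "p \<in> Q" using PQ by (simp add: sym_convex_bodies_def compact_imp_closed)
  qed
  have comm: "hausdorff_dist E P Q = hausdorff_dist E Q P" for P Q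
    by (simp add: hausdorff_dist_def hausdorff_radii_commute)
  show ?thesis
  proof
    fix P Q assume PQ: "P \<in> ?M" "Q \<in> ?M"
    show "hausdorff_dist E P Q = 0 \<longleftrightarrow> P = Q"
    proof
      assume "hausdorff_dist E P Q = 0"
      then show "P = Q" using sub[OF PQ] sub[OF PQ(2,1)] comm[of P Q] by (simp add: order_antisym)
    next
      assume "P = Q"
      then have "0 \<in> ?F P Q" unfolding F[OF PQ] by simp
      then show "hausdorff_dist E P Q = 0" using upper[of 0 P Q] nonneg[of P Q] by linarith
    qed
  next
    fix P Q R assume PQR: "P \<in> ?M" "Q \<in> ?M" "R \<in> ?M"
    show "hausdorff_dist E P R \<le> hausdorff_dist E P Q + hausdorff_dist E Q R"
    proof (rule field_le_epsilon)
      fix e :: real assume "0 < e"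
      then have e: "0 < e / 2" by simp
      obtain r s where r: "r \<in> ?F P Q" "r < hausdorff_dist E P Q + e / 2"
        and s: "s \<in> ?F Q R" "s < hausdorff_dist E Q R + e / 2"
        using approx[OF PQR(1,2) e] approx[OF PQR(2,3) e] by blast
      have rs: "0 \<le> r" "\<forall>p\<in>P. \<exists>q\<in>Q. dist p q \<le> r" "\<forall>q\<in>Q. \<exists>p\<in>P. dist q p \<le> r"
        "0 \<le> s" "\<forall>p\<in>Q. \<exists>q\<in>R. dist p q \<le> s" "\<forall>q\<in>R. \<exists>p\<in>Q. dist q p \<le> s"
        using r(1) s(1) unfolding F[OF PQR(1,2)] F[OF PQR(2,3)] by simp_all
      have "\<exists>z\<in>R. dist x z \<le> r + s" if x: "x \<in> P" for x
      proof -
        obtain y where y: "y \<in> Q" "dist x y \<le> r" using rs(2) x by blast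
        obtain z where z: "z \<in> R" "dist y z \<le> s" using rs(5) y(1) by blast
        have "dist x z \<le> r + s" using y(2) z(2) dist_triangle[of x z y] by linarith
        then show ?thesis using z(1) by blast
      qed
      moreover have "\<exists>x\<in>P. dist z x \<le> r + s" if z: "z \<in> R" for z
      proof -
        obtain y where y: "y \<in> Q" "dist z y \<le> s" using rs(6) z by blast
        obtain x where x: "x \<in> P" "dist y x \<le> r" using rs(3) y(1) by blast
        have "dist z x \<le> r + s" using y(2) x(2) dist_triangle[of z x y] by linarith
        then show ?thesis using x(1) by blast
      qed
      ultimately have "r + s \<in> ?F P R"
        unfolding F[OF PQR(1,3)] using rs(1,4) by simp
      then show "hausdorff_dist E P R \<le> hausdorff_dist E P Q + hausdorff_dist E Q R + e"
        using upper[of "r + s" P R] r(2) s(2) by linarith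
    qed
  qed (use nonneg comm in auto)
qed


subsection \<open>Tensor products of coordinate spaces\<close>

text \<open>
  \<open>coord_space I\<close> is the Euclidean space of real vectors indexed by \<open>I\<close>, isometric to
  \<open>\<real>\<^sup>d\<close> for \<open>d = card I\<close>. For index sets \<open>D i\<close>, the tensor product of the spaces
  \<open>coord_space (D i)\<close> is the space of real arrays indexed by the multi-indices \<open>f\<close> with
  \<open>f i \<in> D i\<close>, and \<open>\<langle>\<cdot>,\<cdot>\<rangle>\<^sub>H\<close> is the standard inner product of arrays
  (see \<open>inner_tensor\<close> and \<open>span_tensor\<close> below).
\<close>

definition coord_space :: "'k::finite set \<Rightarrow> (real ^ 'k) set" where
  "coord_space I = {x. \<forall>j. j \<notin> I \<longrightarrow> x $ j = 0}"

definition tensor :: "('l::finite \<Rightarrow> real ^ 'n::finite) \<Rightarrow> real ^ ('l \<Rightarrow> 'n)" where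
  "tensor x = (\<chi> f. \<Prod>i\<in>UNIV. x i $ f i)"

definition tensor_space :: "('l::finite \<Rightarrow> 'n::finite set) \<Rightarrow> (real ^ ('l \<Rightarrow> 'n)) set" where
  "tensor_space D = coord_space {f. \<forall>i. f i \<in> D i}"

lemma subspace_coord_space: "subspace (coord_space I)"
  by (auto simp: subspace_def coord_space_def)

lemma dim_coord_space:
  fixes I :: "'k::finite set"
  shows "dim (coord_space I) = card I"
proof -
  let ?B = "(\<lambda>j. axis j 1) ` I :: (real ^ 'k) set"
  have "coord_space I = {x. \<forall>i\<in>Basis. i \<notin> ?B \<longrightarrow> x \<bullet> i = 0}"
    by (auto simp: coord_space_def Basis_vec_def inner_axis axis_eq_axis image_iff)
  also have "dim \<dots> = card ?B"
    by (rule dim_substandard) (auto simp: Basis_vec_def)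
  also have "\<dots> = card I"
    by (rule card_image) (auto simp: inj_on_def axis_eq_axis)
  finally show ?thesis .
qed

lemma inner_tensor: "tensor x \<bullet> tensor y = (\<Prod>i\<in>UNIV. x i \<bullet> y i)"
proof -
  have "(\<Prod>i\<in>UNIV. x i \<bullet> y i) = (\<Prod>i\<in>UNIV. \<Sum>j\<in>UNIV. x i $ j * y i $ j)"
    by (simp add: inner_vec_def)
  also have "\<dots> = (\<Sum>f\<in>PiE UNIV (\<lambda>_. UNIV). \<Prod>i\<in>UNIV. x i $ f i * y i $ f i)"
    by (rule prod_sum_PiE) auto
  also have "\<dots> = tensor x \<bullet> tensor y"
    by (simp add: inner_vec_def tensor_def prod.distrib PiE_UNIV_domain)
  finally show ?thesis ..
qed

lemma span_tensor: "span {tensor x |x. \<forall>i. x i \<in> coord_space (D i)} = tensor_space D"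
proof
  show "span {tensor x |x. \<forall>i. x i \<in> coord_space (D i)} \<subseteq> tensor_space D"
    by (rule span_minimal)
      (auto simp: tensor_space_def subspace_coord_space, auto simp: coord_space_def tensor_def)
next
  show "tensor_space D \<subseteq> span {tensor x |x. \<forall>i. x i \<in> coord_space (D i)}"
  proof
    fix t assume t: "t \<in> tensor_space D"
    have ax: "axis f 1 = tensor (\<lambda>i. axis (f i) 1)" for f :: "'a \<Rightarrow> 'b"
      by (auto simp: tensor_def vec_eq_iff axis_def fun_eq_iff)
    have "t = (\<Sum>f\<in>UNIV. t $ f *\<^sub>R axis f 1)"
      using basis_expansion[of t] by (simp add: scalar_mult_eq_scaleR)
    moreover have "t $ f *\<^sub>R axis f 1 \<in> span {tensor x |x. \<forall>i. x i \<in> coord_space (D i)}" for f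
    proof (cases "\<forall>i. f i \<in> D i")
      case True
      then have "\<forall>i. axis (f i) 1 \<in> coord_space (D i)"
        by (auto simp: coord_space_def axis_def)
      then show ?thesis unfolding ax by (intro span_scale span_base) blast
    next
      case False
      then have "t $ f = 0" using t by (auto simp: tensor_space_def coord_space_def)
      then show ?thesis by (simp add: span_zero)
    qed
    ultimately show "t \<in> span {tensor x |x. \<forall>i. x i \<in> coord_space (D i)}"
      by (metis (no_types, lifting) span_sum)
  qed
qed


subsection \<open>Tensorial bodies\<close>

definition proj_tensor_body :: "('l::finite \<Rightarrow> (real ^ 'n::finite) set) \<Rightarrow> (real ^ ('l \<Rightarrow> 'n)) set" where
  "proj_tensor_body Q = convex hull {tensor x |x. \<forall>i. x i \<in> Q i}"

definition inj_tensor_body ::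
    "('l::finite \<Rightarrow> 'n::finite set) \<Rightarrow> ('l \<Rightarrow> (real ^ 'n) set) \<Rightarrow> (real ^ ('l \<Rightarrow> 'n)) set" where
  "inj_tensor_body D Q =
     polar_in (tensor_space D) (proj_tensor_body (\<lambda>i. polar_in (coord_space (D i)) (Q i)))"

definition tensorial_bodies_wrt ::
    "('l::finite \<Rightarrow> 'n::finite set) \<Rightarrow> ('l \<Rightarrow> (real ^ 'n) set) \<Rightarrow> (real ^ ('l \<Rightarrow> 'n)) set set" where
  "tensorial_bodies_wrt D Q =
     {T \<in> sym_convex_bodies (tensor_space D). proj_tensor_body Q \<subseteq> T \<and> T \<subseteq> inj_tensor_body D Q}"

definition tensorial_bodies ::
    "('l::finite \<Rightarrow> 'n::finite set) \<Rightarrow> (real ^ ('l \<Rightarrow> 'n)) set set" where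
  "tensorial_bodies D =
     {T. \<exists>Q. (\<forall>i. Q i \<in> sym_convex_bodies (coord_space (D i))) \<and> T \<in> tensorial_bodies_wrt D Q}"

end

theory Submission
  imports Defs "HOL-Complex_Analysis.Great_Picard"
begin

text \<open>
  Compactness is a form of Blaschke's selection theorem: the distance functions \<open>infdist x (F n)\<close>
  are uniformly bounded and 1-Lipschitz, so by Arzela--Ascoli a subsequence converges uniformly, and
  the zero set of the limit is the Hausdorff limit of the bodies. It keeps a nonempty interior because
  it contains the projective tensor product.

  For closedness, let \<open>T\<close> be a limit of tensorial bodies. Fix an elementary tensor \<open>tensor a\<close> on the
  boundary of \<open>T\<close> and let \<open>Q i\<close> consist of the \<open>x\<close> for which replacing \<open>a i\<close> by \<open>x\<close> in
  \<open>tensor a\<close> yields an element of \<open>T\<close>. Let \<open>T'\<close> be tensorial with respect to \<open>Q'\<close>, with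
  \<open>T \<subseteq> \<kappa> T'\<close> and \<open>T' \<subseteq> \<kappa> T\<close>. The gauge of \<open>T'\<close> is multiplicative on elementary tensors, so \<open>Q i\<close>
  is, up to powers of \<open>\<kappa>\<close>, a multiple of \<open>Q' i\<close>, and the product of these multiples is close to 1.
  Hence \<open>T\<close> lies between the two tensor products of the \<open>Q i\<close> up to a power of \<open>\<kappa>\<close>; let \<open>\<kappa> \<rightarrow> 1\<close>.
\<close>

subsection \<open>Polars and gauges\<close>

text \<open>Replaces the relative interior by a ball about the origin. If \<open>Q\<close> contains
  a relative ball about \<open>a\<close>, then by symmetry it contains one about \<open>- a\<close>,
  and midpoints of the two fill a ball about 0.\<close>

lemma sym_convex_bodies_iff_ball:
  fixes E :: "'a::euclidean_space set"
  assumes E: "subspace E"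
  shows "Q \<in> sym_convex_bodies E \<longleftrightarrow>
    Q \<subseteq> E \<and> compact Q \<and> convex Q \<and> (\<forall>x\<in>Q. - x \<in> Q) \<and> (\<exists>r>0. cball 0 r \<inter> E \<subseteq> Q)"
proof -
  have sym: "Q = uminus ` Q \<longleftrightarrow> (\<forall>x\<in>Q. - x \<in> Q)"
  proof
    assume R: "\<forall>x\<in>Q. - x \<in> Q"
    have "x \<in> uminus ` Q" if "x \<in> Q" for x
      using R that by (intro image_eqI[of _ _ "- x"]) auto
    then show "Q = uminus ` Q" using R by auto
  qed blast
  have "(\<exists>r>0. cball 0 r \<inter> E \<subseteq> Q) \<longleftrightarrow> (top_of_set E) interior_of Q \<noteq> {}"
    if Q: "Q \<subseteq> E" "convex Q" and s: "\<forall>x\<in>Q. - x \<in> Q"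
  proof
    assume "\<exists>r>0. cball 0 r \<inter> E \<subseteq> Q"
    then obtain r where r: "r > 0" "cball 0 r \<inter> E \<subseteq> Q" by blast
    have "openin (top_of_set E) (E \<inter> ball 0 r)" by (simp add: openin_open_Int)
    moreover have "0 \<in> E \<inter> ball 0 r" using r subspace_0[OF E] by simp
    moreover have "E \<inter> ball 0 r \<subseteq> Q" using r by auto
    ultimately have "0 \<in> (top_of_set E) interior_of Q" unfolding interior_of_def by blast
    then show "(top_of_set E) interior_of Q \<noteq> {}" by blast
  next
    assume "(top_of_set E) interior_of Q \<noteq> {}"
    then obtain a U where U: "openin (top_of_set E) U" "a \<in> U" "U \<subseteq> Q"
      unfolding interior_of_def by blast
    then obtain e where e: "e > 0" "ball a e \<inter> E \<subseteq> U" by (meson openin_contains_ball)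
    have "cball 0 (e/2) \<inter> E \<subseteq> Q"
    proof
      fix z assume z: "z \<in> cball 0 (e/2) \<inter> E"
      have aE: "a \<in> E" using U Q by blast
      have "a + z \<in> Q" "a - z \<in> Q"
        using e z U aE E by (auto intro!: subsetD[OF U(3)] subsetD[OF e(2)] simp: dist_norm subspace_add subspace_diff)
      then have "a + z \<in> Q" "z - a \<in> Q" using s by force+
      then have "(1/2) *\<^sub>R (a + z) + (1/2) *\<^sub>R (z - a) \<in> Q"
        by (intro convexD[OF Q(2)]) auto
      moreover have "(1/2) *\<^sub>R (a + z) + (1/2) *\<^sub>R (z - a) = z"
        by (simp add: algebra_simps flip: scaleR_add_left)
      ultimately show "z \<in> Q" by simp
    qed
    then show "\<exists>r>0. cball 0 r \<inter> E \<subseteq> Q" using e by (intro exI[of _ "e/2"]) auto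
  qed
  then show ?thesis unfolding sym_convex_bodies_def mem_Collect_eq sym by blast
qed

lemma sym_convex_bodiesE:
  fixes E :: "'a::euclidean_space set"
  assumes "subspace E" "Q \<in> sym_convex_bodies E"
  obtains r R where "Q \<subseteq> E" "compact Q" "convex Q" "\<And>x. x \<in> Q \<Longrightarrow> - x \<in> Q" "0 \<in> Q"
    "0 < r" "\<And>x. x \<in> E \<Longrightarrow> norm x \<le> r \<Longrightarrow> x \<in> Q" "0 < R" "\<And>x. x \<in> Q \<Longrightarrow> norm x \<le> R"
proof -
  note * = assms(2)[unfolded sym_convex_bodies_iff_ball[OF assms(1)]]
  obtain r where r: "r > 0" "cball 0 r \<inter> E \<subseteq> Q" using * by blast
  obtain R where R: "R > 0" "\<forall>x\<in>Q. norm x \<le> R"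
    using * compact_imp_bounded bounded_pos by metis
  have "0 \<in> Q" using r subspace_0[OF assms(1)] by auto
  moreover have "x \<in> Q" if "x \<in> E" "norm x \<le> r" for x using r that by auto
  ultimately show ?thesis using that[of r R] * r(1) R by blast
qed

lemma convex_scale_mem:
  fixes Q :: "'a::real_vector set"
  assumes "convex Q" "0 \<in> Q" "x \<in> Q" "0 \<le> s" "s \<le> 1"
  shows "s *\<^sub>R x \<in> Q"
  using convexD[OF assms(1,3,2), of s "1 - s"] assms by simp

section \<open>Polar bodies and the bipolar theorem\<close>

lemma mem_polar_in: "y \<in> polar_in E Q \<longleftrightarrow> y \<in> E \<and> (\<forall>x\<in>Q. \<bar>x \<bullet> y\<bar> \<le> 1)"
  by (simp add: polar_in_def SUP_le_iff one_ereal_def)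

lemma closed_polar_in:
  fixes E :: "'a::euclidean_space set"
  assumes "subspace E"
  shows "closed (polar_in E Q)"
proof -
  have "polar_in E Q = E \<inter> (\<Inter>x\<in>Q. {y. \<bar>x \<bullet> y\<bar> \<le> 1})"
    by (auto simp: mem_polar_in)
  then show ?thesis
    using closed_subspace[OF assms] by (auto intro!: closed_INT closed_Collect_le continuous_intros)
qed

lemma convex_polar_in:
  fixes E :: "'a::euclidean_space set"
  assumes "subspace E"
  shows "convex (polar_in E Q)"
proof (rule convexI)
  fix x y and u v :: real
  assume a: "x \<in> polar_in E Q" "y \<in> polar_in E Q" "0 \<le> u" "0 \<le> v" "u + v = 1"
  have "\<bar>q \<bullet> (u *\<^sub>R x + v *\<^sub>R y)\<bar> \<le> 1" if "q \<in> Q" for q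
  proof -
    have "\<bar>q \<bullet> (u *\<^sub>R x + v *\<^sub>R y)\<bar> \<le> u * \<bar>q \<bullet> x\<bar> + v * \<bar>q \<bullet> y\<bar>"
      using a abs_triangle_ineq[of "u * (q \<bullet> x)" "v * (q \<bullet> y)"]
      by (simp add: inner_add_right abs_mult)
    also have "\<dots> \<le> u * 1 + v * 1"
      using a that by (intro add_mono mult_left_mono) (auto simp: mem_polar_in)
    finally show ?thesis using a by simp
  qed
  then show "u *\<^sub>R x + v *\<^sub>R y \<in> polar_in E Q"
    using a assms by (auto simp: mem_polar_in subspace_add subspace_scale)
qed

text \<open>Test \<open>y\<close> against the point of norm \<open>r\<close> in its own direction,
  which lies in \<open>Q\<close>.\<close>

lemma polar_in_norm_le:
  fixes E :: "'a::euclidean_space set"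
  assumes E: "subspace E" and r: "0 < r" "cball 0 r \<inter> E \<subseteq> Q" and y: "y \<in> polar_in E Q"
  shows "norm y \<le> 1 / r"
proof (cases "y = 0")
  case False
  have "(r / norm y) *\<^sub>R y \<in> Q"
    using r y False E by (auto intro!: subsetD[OF r(2)] simp: mem_polar_in subspace_scale)
  then have "\<bar>((r / norm y) *\<^sub>R y) \<bullet> y\<bar> \<le> 1" using y unfolding mem_polar_in by blast
  moreover have "((r / norm y) *\<^sub>R y) \<bullet> y = r * norm y"
    using False by (simp add: dot_square_norm power2_eq_square)
  ultimately show ?thesis using r by (simp add: field_simps)
qed (use r in simp)

text \<open>A ball inside \<open>Q\<close> bounds the polar, and a bound on \<open>Q\<close> puts a
  ball inside the polar by Cauchy-Schwarz. The form with a bounded \<open>Q\<close> containing a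
  ball lets it apply directly to \<open>proj_tensor_body\<close>.\<close>

lemma polar_in_sym_convex_bodies:
  fixes E :: "'a::euclidean_space set"
  assumes E: "subspace E" and r: "0 < r" "cball 0 r \<inter> E \<subseteq> Q" and Q: "bounded Q"
  shows "polar_in E Q \<in> sym_convex_bodies E"
proof -
  have "bounded (polar_in E Q)"
    using polar_in_norm_le[OF E r] by (auto simp: bounded_iff)
  then have "compact (polar_in E Q)"
    using closed_polar_in[OF E] by (simp add: compact_eq_bounded_closed)
  moreover obtain R where R: "R > 0" "\<forall>x\<in>Q. norm x \<le> R"
    using Q bounded_pos by metis
  have "\<bar>x \<bullet> y\<bar> \<le> 1" if "norm y \<le> 1 / R" "x \<in> Q" for x y
  proof -
    have "\<bar>x \<bullet> y\<bar> \<le> norm x * norm y" by (rule Cauchy_Schwarz_ineq2)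
    also have "\<dots> \<le> R * (1 / R)" using that R by (intro mult_mono) auto
    finally show ?thesis using R by simp
  qed
  then have "cball 0 (1 / R) \<inter> E \<subseteq> polar_in E Q" by (auto simp: mem_polar_in)
  then have "\<exists>r>0. cball 0 r \<inter> E \<subseteq> polar_in E Q" using R by (intro exI[of _ "1/R"]) auto
  ultimately show ?thesis unfolding sym_convex_bodies_iff_ball[OF E]
    using convex_polar_in[OF E] E by (auto simp: mem_polar_in subspace_neg)
qed

lemma polar_sym_convex_body:
  fixes E :: "'a::euclidean_space set"
  assumes E: "subspace E" and Q: "Q \<in> sym_convex_bodies E"
  shows "polar_in E Q \<in> sym_convex_bodies E"
proof -
  from Q obtain r where "0 < r" "cball 0 r \<inter> E \<subseteq> Q" "compact Q"
    unfolding sym_convex_bodies_iff_ball[OF E] by blast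
  then show ?thesis by (intro polar_in_sym_convex_bodies[OF E]) (auto simp: compact_imp_bounded)
qed

text \<open>The separating vector is the normal at the point of \<open>Q\<close> closest to
  \<open>x\<close>, rescaled. Symmetry of \<open>Q\<close> turns its one-sided bound on
  \<open>Q\<close> into the two-sided one that the polar demands.\<close>

lemma separate_by_polar:
  fixes E :: "'a::euclidean_space set"
  assumes E: "subspace E" and Q: "Q \<in> sym_convex_bodies E" and x: "x \<in> E" "x \<notin> Q"
  obtains y where "y \<in> polar_in E Q" "1 < x \<bullet> y"
proof -
  obtain r R where *: "Q \<subseteq> E" "compact Q" "convex Q" "\<And>x. x \<in> Q \<Longrightarrow> - x \<in> Q" "0 \<in> Q"
    using sym_convex_bodiesE[OF E Q] by metis
  define p where "p = closest_point Q x"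
  have p: "p \<in> Q" unfolding p_def using * by (intro closest_point_in_set) (auto simp: compact_imp_closed)
  define u where "u = x - p"
  have u: "u \<noteq> 0" "u \<in> E" using p x * E by (auto simp: u_def subspace_diff)
  have le: "u \<bullet> q \<le> u \<bullet> p" if "q \<in> Q" for q
    using closest_point_dot[OF *(3) compact_imp_closed[OF *(2)] that, of x]
    by (simp add: u_def p_def inner_diff_right)
  have lt: "u \<bullet> p < u \<bullet> x"
    using u by (metis diff_gt_0_iff_gt inner_diff_right inner_gt_zero_iff u_def)
  have nn: "0 \<le> u \<bullet> p" using le[OF *(5)] by simp
  \<comment> \<open>Any level strictly between the maximum of \<open>u\<close> on \<open>Q\<close>
    and its value at \<open>x\<close> would do. The midpoint is positive because
    \<open>u \<bullet> p\<close> is nonnegative, so division by it is allowed.\<close>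
  define c where "c = (u \<bullet> p + u \<bullet> x) / 2"
  have c: "0 < c" "u \<bullet> p < c" "c < u \<bullet> x" using nn lt by (auto simp: c_def)
  have "\<bar>q \<bullet> ((1 / c) *\<^sub>R u)\<bar> \<le> 1" if "q \<in> Q" for q
    using le[OF that] le[OF *(4)[OF that]] c by (simp add: inner_commute abs_le_iff field_simps)
  then have "(1 / c) *\<^sub>R u \<in> polar_in E Q"
    using u E by (auto simp: mem_polar_in subspace_scale)
  moreover have "1 < x \<bullet> ((1 / c) *\<^sub>R u)" using c by (simp add: inner_commute field_simps)
  ultimately show ?thesis using that by blast
qed

text \<open>On \<open>E\<close> this is the Minkowski gauge of \<open>Q\<close>, by the bipolar theorem. As the support function
  of the compact set \<open>polar_in E Q\<close> it is attained.\<close>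

definition polar_gauge :: "'a::euclidean_space set \<Rightarrow> 'a set \<Rightarrow> 'a \<Rightarrow> real" where
  "polar_gauge E Q x = (SUP y\<in>polar_in E Q. x \<bullet> y)"

context
  fixes E :: "'a::euclidean_space set" and Q
  assumes E: "subspace E" and Q: "Q \<in> sym_convex_bodies E"
begin

lemma inner_le_polar_gauge:
  assumes "y \<in> polar_in E Q"
  shows "x \<bullet> y \<le> polar_gauge E Q x"
proof -
  have "compact ((\<lambda>y. x \<bullet> y) ` polar_in E Q)"
    using polar_sym_convex_body[OF E Q] unfolding sym_convex_bodies_def
    by (intro compact_continuous_image continuous_intros) auto
  then have "bdd_above ((\<lambda>y. x \<bullet> y) ` polar_in E Q)"
    by (simp add: bounded_imp_bdd_above compact_imp_bounded)
  then show ?thesis unfolding polar_gauge_def using assms by (rule cSUP_upper2) simp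
qed

lemma polar_gauge_attained:
  obtains y where "y \<in> polar_in E Q" "polar_gauge E Q x = x \<bullet> y"
proof -
  note P = polar_sym_convex_body[OF E Q]
  have "compact (polar_in E Q)" using P by (simp add: sym_convex_bodies_def)
  moreover have "continuous_on (polar_in E Q) (\<lambda>y. x \<bullet> y)" by (intro continuous_intros)
  ultimately obtain y where y: "y \<in> polar_in E Q" "\<And>z. z \<in> polar_in E Q \<Longrightarrow> x \<bullet> z \<le> x \<bullet> y"
    using continuous_attains_sup[of "polar_in E Q" "\<lambda>y. x \<bullet> y"] sym_convex_bodies_nonempty[OF P]
    by blast
  then have "polar_gauge E Q x \<le> x \<bullet> y" unfolding polar_gauge_def by (intro cSUP_least) auto
  then show ?thesis using that y(1) inner_le_polar_gauge[OF y(1), of x] by force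
qed

lemma polar_gauge_nonneg: "0 \<le> polar_gauge E Q x"
  using inner_le_polar_gauge[of 0 x] subspace_0[OF E] by (simp add: mem_polar_in)

lemma polar_gauge_pos:
  assumes "x \<in> E" "x \<noteq> 0"
  shows "0 < polar_gauge E Q x"
proof -
  obtain r where r: "0 < r" "\<And>y. y \<in> E \<Longrightarrow> norm y \<le> r \<Longrightarrow> y \<in> polar_in E Q"
    using sym_convex_bodiesE[OF E polar_sym_convex_body[OF E Q]] by metis
  have "(r / norm x) *\<^sub>R x \<in> polar_in E Q"
    using assms r E by (intro r(2)) (auto simp: subspace_scale)
  moreover have "0 < x \<bullet> ((r / norm x) *\<^sub>R x)" using assms r by simp
  ultimately show ?thesis using inner_le_polar_gauge by (metis less_le_trans)
qed

text \<open>The bipolar theorem: points outside \<open>Q\<close> are excluded by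
  \<open>separate_by_polar\<close>.\<close>

lemma polar_gauge_le_1_iff:
  assumes "x \<in> E"
  shows "polar_gauge E Q x \<le> 1 \<longleftrightarrow> x \<in> Q"
proof
  assume "x \<in> Q"
  then show "polar_gauge E Q x \<le> 1"
    by (metis polar_gauge_attained mem_polar_in abs_le_D1)
next
  assume "polar_gauge E Q x \<le> 1"
  then show "x \<in> Q"
    using separate_by_polar[OF E Q assms] inner_le_polar_gauge[of _ x] by (metis order.trans not_le)
qed

lemma divide_polar_gauge_mem:
  assumes "x \<in> E" "x \<noteq> 0"
  shows "(1 / polar_gauge E Q x) *\<^sub>R x \<in> Q"
proof -
  let ?x = "(1 / polar_gauge E Q x) *\<^sub>R x"
  obtain y where y: "y \<in> polar_in E Q" "polar_gauge E Q ?x = ?x \<bullet> y"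
    by (rule polar_gauge_attained)
  have "?x \<bullet> y \<le> 1"
    using inner_le_polar_gauge[OF y(1), of x] polar_gauge_pos[OF assms] by simp
  then show ?thesis
    using y polar_gauge_le_1_iff[of ?x] assms E by (simp add: subspace_scale)
qed

end

subsection \<open>The space of convex bodies\<close>

text \<open>Convergence is expressed by mutual nearness of points because the limit set is not yet
  known to be a convex body.\<close>

theorem Blaschke_selection:
  fixes F :: "nat \<Rightarrow> 'a::euclidean_space set"
  assumes K: "compact K" and F: "\<And>n. compact (F n)" "\<And>n. F n \<noteq> {}" "\<And>n. F n \<subseteq> K"
  obtains L r where "strict_mono (r :: nat \<Rightarrow> nat)" "compact L" "L \<subseteq> K"
    "\<And>e. 0 < e \<Longrightarrow> \<forall>\<^sub>F n in sequentially.
       (\<forall>x\<in>F (r n). \<exists>y\<in>L. dist x y \<le> e) \<and> (\<forall>y\<in>L. \<exists>x\<in>F (r n). dist y x \<le> e)"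
proof -
  obtain B where B: "\<And>x. x \<in> K \<Longrightarrow> norm x \<le> B"
    using compact_imp_bounded[OF K] by (auto simp: bounded_iff)
  have "norm (infdist x (F n)) \<le> 2 * B" if x: "x \<in> K" for n x
  proof -
    obtain y where y: "y \<in> F n" using F by blast
    have "infdist x (F n) \<le> dist x y" by (rule infdist_le[OF y])
    also have "\<dots> \<le> norm x + norm y" by (simp add: dist_norm norm_triangle_ineq4)
    also have "\<dots> \<le> 2 * B" using B[OF x] B[of y] F(3) y by fastforce
    finally show ?thesis by (simp add: infdist_nonneg)
  qed
  moreover have "\<exists>d>0. \<forall>n y. y \<in> K \<and> norm (x - y) < d \<longrightarrow> norm (infdist x (F n) - infdist y (F n)) < e"
    if "0 < e" for x and e :: real
    using that infdist_triangle_abs[of x] unfolding dist_norm real_norm_def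
    by (intro exI[of _ e]) (auto intro: le_less_trans)
  ultimately obtain g r where g: "continuous_on K g" and r: "strict_mono (r :: nat \<Rightarrow> nat)"
    and lim: "\<And>e. 0 < e \<Longrightarrow> \<exists>N. \<forall>n x. n \<ge> N \<and> x \<in> K \<longrightarrow> norm (infdist x (F (r n)) - g x) < e"
    using Arzela_Ascoli[OF K, of "\<lambda>n x. infdist x (F n)" "2 * B"] by metis
  define L where "L = {x \<in> K. g x = 0}"
  have "closed L" unfolding L_def
    using continuous_closed_preimage[OF g compact_imp_closed[OF K], of "{0}"]
    by (simp add: vimage_def Int_def)
  moreover have LK: "L \<subseteq> K" by (auto simp: L_def)
  ultimately have L: "compact L" using K by (metis compact_Int_closed inf.absorb_iff2)
  have lim': "(\<lambda>n. infdist x (F (r n))) \<longlonglongrightarrow> g x" if "x \<in> K" for x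
    using lim that by (simp add: LIMSEQ_iff) metis
  \<comment> \<open>Points of \<open>F (r n)\<close> closest to \<open>x\<close> accumulate at some
    \<open>l\<close> with \<open>dist x l = g x\<close>. Since \<open>l\<close> is a limit of points
    of these sets, \<open>g l = 0\<close>, so \<open>l\<close> belongs to \<open>L\<close>.\<close>
  have near: "\<exists>y\<in>L. dist x y \<le> g x" if x: "x \<in> K" for x
  proof -
    have "\<exists>y\<in>F (r n). infdist x (F (r n)) = dist x y" for n
      using infdist_attains_inf[of "F (r n)" x] F by (metis compact_imp_closed)
    then obtain y where y: "\<And>n. y n \<in> F (r n)" "\<And>n. infdist x (F (r n)) = dist x (y n)" by metis
    have yK: "\<And>n. y n \<in> K" using y F by blast
    obtain l s where l: "l \<in> K" "strict_mono (s :: nat \<Rightarrow> nat)" "(y \<circ> s) \<longlonglongrightarrow> l"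
      using K yK unfolding compact_eq_seq_compact_metric seq_compact_def by metis
    have "(\<lambda>n. dist x ((y \<circ> s) n)) \<longlonglongrightarrow> dist x l" using l(3) by (intro tendsto_intros)
    moreover have "(\<lambda>n. dist x ((y \<circ> s) n)) \<longlonglongrightarrow> g x"
      using LIMSEQ_subseq_LIMSEQ[OF lim'[OF x] l(2)] by (simp add: y(2) o_def)
    ultimately have "dist x l = g x" by (rule LIMSEQ_unique)
    moreover have "g l = 0"
    proof (rule LIMSEQ_unique)
      show "(\<lambda>n. infdist l (F (r (s n)))) \<longlonglongrightarrow> g l"
        using LIMSEQ_subseq_LIMSEQ[OF lim'[OF l(1)] l(2)] by (simp add: o_def)
      show "(\<lambda>n. infdist l (F (r (s n)))) \<longlonglongrightarrow> 0"
      proof (rule tendsto_sandwich[OF always_eventually always_eventually tendsto_const])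
        show "(\<lambda>n. dist l ((y \<circ> s) n)) \<longlonglongrightarrow> 0"
          using tendsto_dist[OF tendsto_const l(3), of l] by simp
      qed (auto simp: infdist_nonneg y intro: infdist_le)
    qed
    ultimately show ?thesis using l by (auto simp: L_def)
  qed
  show ?thesis
  proof (rule that[OF r L LK])
    fix e :: real assume "0 < e"
    then obtain N where N: "\<And>n x. n \<ge> N \<Longrightarrow> x \<in> K \<Longrightarrow> \<bar>infdist x (F (r n)) - g x\<bar> < e"
      using lim by (metis real_norm_def)
    have "(\<forall>x\<in>F (r n). \<exists>y\<in>L. dist x y \<le> e) \<and> (\<forall>y\<in>L. \<exists>x\<in>F (r n). dist y x \<le> e)"
      if n: "n \<ge> N" for n
    proof (intro conjI ballI)
      fix x assume x: "x \<in> F (r n)"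
      then have "x \<in> K" using F by blast
      moreover have "g x < e" using N[OF n, of x] x \<open>x \<in> K\<close> by simp
      ultimately show "\<exists>y\<in>L. dist x y \<le> e" using near[of x] by force
    next
      fix y assume y: "y \<in> L"
      then have "infdist y (F (r n)) < e" using N[OF n, of y] by (simp add: L_def)
      moreover obtain x where "x \<in> F (r n)" "infdist y (F (r n)) = dist y x"
        using infdist_attains_inf[of "F (r n)" y] F by (metis compact_imp_closed)
      ultimately show "\<exists>x\<in>F (r n). dist y x \<le> e" by force
    qed
    then show "\<forall>\<^sub>F n in sequentially.
       (\<forall>x\<in>F (r n). \<exists>y\<in>L. dist x y \<le> e) \<and> (\<forall>y\<in>L. \<exists>x\<in>F (r n). dist y x \<le> e)"
      by (auto simp: eventually_sequentially)
  qed
qed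

section \<open>Hausdorff distance, pointwise nearness and dilations\<close>

lemma hausdorff_dist_le:
  fixes E :: "'a::euclidean_space set"
  assumes "subspace E" "P \<subseteq> E" "Q \<subseteq> E" "0 \<le> r"
    and "\<forall>p\<in>P. \<exists>q\<in>Q. dist p q \<le> r" "\<forall>q\<in>Q. \<exists>p\<in>P. dist q p \<le> r"
  shows "hausdorff_dist E P Q \<le> r"
proof -
  have "r \<in> hausdorff_radii E P Q"
    using hausdorff_inclusion_iff[of E P Q r] hausdorff_inclusion_iff[of E Q P r] assms
    by (simp add: hausdorff_radii_def)
  moreover have "bdd_below (hausdorff_radii E P Q)"
    by (rule bdd_belowI[of _ 0]) (simp add: hausdorff_radii_def)
  ultimately show ?thesis by (auto simp: hausdorff_dist_def intro: cInf_lower)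
qed

lemma hausdorff_dist_lessD:
  fixes E :: "'a::euclidean_space set"
  assumes E: "subspace E" and PQ: "P \<in> sym_convex_bodies E" "Q \<in> sym_convex_bodies E"
    and less: "hausdorff_dist E P Q < e"
  shows "\<forall>p\<in>P. \<exists>q\<in>Q. dist p q \<le> e" "\<forall>q\<in>Q. \<exists>p\<in>P. dist q p \<le> e"
proof -
  have PE: "P \<subseteq> E" "Q \<subseteq> E" using PQ by (simp_all add: sym_convex_bodies_def)
  have iff: "r \<in> hausdorff_radii E P Q \<longleftrightarrow>
      0 \<le> r \<and> (\<forall>p\<in>P. \<exists>q\<in>Q. dist p q \<le> r) \<and> (\<forall>q\<in>Q. \<exists>p\<in>P. dist q p \<le> r)" for r
    using hausdorff_inclusion_iff[OF E PE, of r] hausdorff_inclusion_iff[OF E PE(2,1), of r]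
    unfolding hausdorff_radii_def mem_Collect_eq by (cases "0 \<le> r") simp_all
  obtain r1 R1 where P: "0 \<in> P" "0 < R1" "\<And>x. x \<in> P \<Longrightarrow> norm x \<le> R1"
    using sym_convex_bodiesE[OF E PQ(1)] by metis
  obtain r2 R2 where Q: "0 \<in> Q" "0 < R2" "\<And>x. x \<in> Q \<Longrightarrow> norm x \<le> R2"
    using sym_convex_bodiesE[OF E PQ(2)] by metis
  \<comment> \<open>Both bodies contain the origin, which serves as the nearby point for every point
    of the other body. An admissible radius therefore exists, and the default value 0 of
    \<open>hausdorff_dist\<close> does not occur.\<close>
  have "max R1 R2 \<in> hausdorff_radii E P Q"
    unfolding iff using P Q by (intro conjI ballI bexI[of _ 0]) (auto simp: le_max_iff_disj)
  then have "hausdorff_radii E P Q \<noteq> {}" by blast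
  then obtain r where "r \<in> hausdorff_radii E P Q" "r < e"
    using less cInf_lessD[of "hausdorff_radii E P Q" e] by (auto simp: hausdorff_dist_def)
  then show "\<forall>p\<in>P. \<exists>q\<in>Q. dist p q \<le> e" "\<forall>q\<in>Q. \<exists>p\<in>P. dist q p \<le> e"
    unfolding iff by (meson order.trans less_imp_le)+
qed

text \<open>Passes from additive to multiplicative closeness, which is what gauges can use. Every
  \<open>Q\<close> close enough to \<open>P\<close> still contains a ball of half the radius
  \<open>r\<close>, and a small additive error is absorbed by \<open>e\<close> times that
  ball.\<close>

lemma hausdorff_near_imp_dilate:
  fixes E :: "'a::euclidean_space set"
  assumes E: "subspace E" and P: "P \<in> sym_convex_bodies E" and e: "0 < e"
  obtains \<delta> where "0 < \<delta>"
    "\<And>Q. Q \<in> sym_convex_bodies E \<Longrightarrow> hausdorff_dist E P Q < \<delta> \<Longrightarrow>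
       P \<subseteq> (*\<^sub>R) (1 + e) ` Q \<and> Q \<subseteq> (*\<^sub>R) (1 + e) ` P"
proof -
  obtain r R where p: "P \<subseteq> E" "compact P" "convex P" "0 \<in> P" "0 < r"
      "\<And>x. x \<in> E \<Longrightarrow> norm x \<le> r \<Longrightarrow> x \<in> P"
    using sym_convex_bodiesE[OF E P] by metis
  define \<rho> where "\<rho> = r / 2"
  have \<rho>: "0 < \<rho>" using p by (simp add: \<rho>_def)
  \<comment> \<open>Write \<open>a\<close> as \<open>b\<close> plus \<open>e\<close> times
    \<open>(1 / e) *\<^sub>R (a - b)\<close>. The second vector lies in the ball inside
    \<open>B\<close>, so dividing by \<open>1 + e\<close> gives a convex combination of points of
    \<open>B\<close>.\<close>
  have dil: "A \<subseteq> (*\<^sub>R) (1 + e) ` B"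
    if A: "A \<subseteq> E" and B: "B \<subseteq> E" "convex B" "\<And>x. x \<in> E \<Longrightarrow> norm x \<le> \<rho> \<Longrightarrow> x \<in> B"
      and near: "\<forall>a\<in>A. \<exists>b\<in>B. dist a b \<le> \<rho> * e" for A B
  proof
    fix a assume a: "a \<in> A"
    then obtain b where b: "b \<in> B" "dist a b \<le> \<rho> * e" using near by blast
    have "(1 / e) *\<^sub>R (a - b) \<in> B"
    proof (rule B(3))
      show "(1 / e) *\<^sub>R (a - b) \<in> E" using a b A B(1) E by (meson subsetD subspace_diff subspace_scale)
      show "norm ((1 / e) *\<^sub>R (a - b)) \<le> \<rho>"
        unfolding norm_scaleR using b e by (simp add: dist_norm field_simps)
    qed
    then have "(1 / (1 + e)) *\<^sub>R b + (e / (1 + e)) *\<^sub>R ((1 / e) *\<^sub>R (a - b)) \<in> B"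
      using e b by (intro convexD[OF B(2)]) (auto simp: field_simps)
    moreover have "(1 / (1 + e)) *\<^sub>R b + (e / (1 + e)) *\<^sub>R ((1 / e) *\<^sub>R (a - b)) = (1 / (1 + e)) *\<^sub>R a"
      using e by (simp add: algebra_simps)
    ultimately have "(1 / (1 + e)) *\<^sub>R a \<in> B" by simp
    then show "a \<in> (*\<^sub>R) (1 + e) ` B"
      using e by (intro image_eqI[of _ _ "(1 / (1 + e)) *\<^sub>R a"]) auto
  qed
  \<comment> \<open>The bound by \<open>\<rho>\<close> keeps the half-radius ball inside
    \<open>Q\<close>; the bound by \<open>\<rho> * e\<close> is the error that \<open>dil\<close>
    can absorb.\<close>
  define \<delta> where "\<delta> = min \<rho> (\<rho> * e)"
  have \<delta>: "0 < \<delta>" "\<delta> \<le> \<rho>" "\<delta> \<le> \<rho> * e" using \<rho> e by (auto simp: \<delta>_def)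
  show ?thesis
  proof (rule that[OF \<delta>(1)])
    fix Q assume Q: "Q \<in> sym_convex_bodies E" and d: "hausdorff_dist E P Q < \<delta>"
    obtain r' R' where q: "Q \<subseteq> E" "compact Q" "convex Q" "0 \<in> Q"
      using sym_convex_bodiesE[OF E Q] by metis
    note near = hausdorff_dist_lessD[OF E P Q d]
    \<comment> \<open>A polar vector separating \<open>z\<close> from \<open>Q\<close> would also keep \<open>Q\<close> away from the ball in \<open>P\<close>.\<close>
    have ball: "z \<in> Q" if z: "z \<in> E" "norm z \<le> \<rho>" for z
    proof (rule ccontr)
      assume "z \<notin> Q"
      then obtain y where y: "y \<in> polar_in E Q" "1 < z \<bullet> y"
        using separate_by_polar[OF E Q z(1)] by blast
      then have y0: "norm y > 0" by auto
      let ?w = "(r / norm y) *\<^sub>R y"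
      have "?w \<in> P" using y y0 p(5) E by (intro p(6)) (auto simp: mem_polar_in subspace_scale)
      then obtain q where q: "q \<in> Q" "dist ?w q \<le> \<delta>" using near by blast
      have "r * norm y = ?w \<bullet> y" using y0 by (simp add: dot_square_norm power2_eq_square)
      also have "\<dots> = q \<bullet> y + (?w - q) \<bullet> y" by (simp add: inner_diff_left)
      also have "\<dots> \<le> 1 + norm (?w - q) * norm y"
        using y(1) q(1) norm_cauchy_schwarz[of "?w - q" y] by (fastforce simp: mem_polar_in)
      also have "\<dots> \<le> 1 + \<rho> * norm y"
        using q(2) \<delta>(2) by (simp add: dist_norm mult_right_mono)
      finally have "\<rho> * norm y \<le> 1" by (simp add: \<rho>_def)
      moreover have "z \<bullet> y \<le> \<rho> * norm y"
        using norm_cauchy_schwarz[of z y] z(2) by (meson mult_right_mono norm_ge_zero order.trans)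
      ultimately show False using y(2) by linarith
    qed
    have "\<forall>p\<in>P. \<exists>q\<in>Q. dist p q \<le> \<rho> * e" "\<forall>q\<in>Q. \<exists>p\<in>P. dist q p \<le> \<rho> * e"
      using near \<delta>(3) by (meson order.trans)+
    then show "P \<subseteq> (*\<^sub>R) (1 + e) ` Q \<and> Q \<subseteq> (*\<^sub>R) (1 + e) ` P"
      using dil[OF p(1) q(1,3) ball] dil[OF q(1) p(1,3)] p(5,6) by (auto simp: \<rho>_def)
  qed
qed

subsection \<open>Projective and injective tensor products\<close>

lemma subspace_tensor_space: "subspace (tensor_space D)"
  by (simp add: tensor_space_def subspace_coord_space)

lemma tensor_in_tensor_space:
  assumes "\<And>i. x i \<in> coord_space (D i)"
  shows "tensor x \<in> tensor_space D"
proof -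
  have "tensor x \<in> span {tensor x |x. \<forall>i. x i \<in> coord_space (D i)}"
    using assms by (intro span_base) blast
  then show ?thesis by (simp only: span_tensor)
qed

lemma tensor_scaleR:
  "tensor (\<lambda>i. c i *\<^sub>R x i) = (\<Prod>i\<in>UNIV. c i) *\<^sub>R tensor x"
  by (simp add: tensor_def vec_eq_iff prod.distrib)

lemma tensor_fun_upd:
  "tensor (z(i := x)) $ f = x $ f i * (\<Prod>k\<in>UNIV - {i}. z k $ f k)"
  by (simp add: tensor_def prod.remove[of UNIV i])

lemma linear_tensor_fun_upd: "linear (\<lambda>x. tensor (z(i := x)))"
  by (rule linearI) (auto simp: vec_eq_iff tensor_fun_upd algebra_simps)

lemma tensor_eq_0:
  assumes "x i = 0"
  shows "tensor x = 0"
proof -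
  have "tensor x = tensor (x(i := 0))" using assms by (metis fun_upd_triv)
  then show ?thesis using linear_0[OF linear_tensor_fun_upd] by metis
qed

lemma norm_tensor: "norm (tensor x) = (\<Prod>i\<in>UNIV. norm (x i))"
proof (rule power2_eq_imp_eq)
  show "(norm (tensor x))\<^sup>2 = (\<Prod>i\<in>UNIV. norm (x i))\<^sup>2"
    by (simp add: power2_norm_eq_inner inner_tensor prod_power_distrib)
qed (simp_all add: prod_nonneg)

lemma tensor_axis: "tensor (\<lambda>i. axis (f i) 1) = axis f 1"
  by (auto simp: tensor_def vec_eq_iff axis_def fun_eq_iff)

lemma tensor_in_proj_tensor_body: "(\<And>i. x i \<in> Q i) \<Longrightarrow> tensor x \<in> proj_tensor_body Q"
  unfolding proj_tensor_body_def by (intro hull_inc) blast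

lemma bounded_proj_tensor_body:
  assumes "\<And>i. bounded (Q i)"
  shows "bounded (proj_tensor_body Q)"
proof -
  obtain R where R: "\<And>i x. x \<in> Q i \<Longrightarrow> norm x \<le> R i"
    using assms unfolding bounded_iff by metis
  have "norm (tensor x) \<le> (\<Prod>i\<in>UNIV. R i)" if "\<forall>i. x i \<in> Q i" for x
    unfolding norm_tensor using R that by (intro prod_mono) auto
  then have "bounded {tensor x |x. \<forall>i. x i \<in> Q i}" unfolding bounded_iff by blast
  then show ?thesis unfolding proj_tensor_body_def by (rule bounded_convex_hull)
qed

text \<open>Small multiples of the axis tensors lie in the body, and a small array is an average of
  such multiples over all multi-indices. This ball is also the source of nonempty interior for
  limits and Minkowski combinations.\<close>

lemma proj_tensor_body_contains_ball:
  fixes D :: "'l::finite \<Rightarrow> 'n::finite set"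
  assumes Q: "\<And>i. Q i \<in> sym_convex_bodies (coord_space (D i))"
  obtains r where "0 < r" "cball 0 r \<inter> tensor_space D \<subseteq> proj_tensor_body Q"
proof -
  have "\<exists>r>0. \<forall>x\<in>coord_space (D i). norm x \<le> r \<longrightarrow> x \<in> Q i" for i
    using sym_convex_bodiesE[OF subspace_coord_space Q[of i]] by metis
  then obtain \<rho> where \<rho>: "\<And>i. 0 < \<rho> i"
      "\<And>i x. x \<in> coord_space (D i) \<Longrightarrow> norm x \<le> \<rho> i \<Longrightarrow> x \<in> Q i"
    by metis
  let ?P = "\<Prod>i\<in>UNIV. \<rho> i" and ?N = "real (card (UNIV :: ('l \<Rightarrow> 'n) set))"
  have P: "0 < ?P" using \<rho> by (intro prod_pos) auto
  have N: "0 < ?N" by (simp add: card_gt_0_iff)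
  have 0: "0 \<in> proj_tensor_body Q"
  proof -
    have "tensor (\<lambda>i. 0 :: real ^ 'n) \<in> proj_tensor_body Q"
      by (rule tensor_in_proj_tensor_body, rule \<rho>(2))
        (use \<rho>(1) in \<open>auto simp: less_imp_le subspace_0 subspace_coord_space\<close>)
    then show ?thesis by (simp add: tensor_eq_0)
  qed
  have gen: "s *\<^sub>R axis f 1 \<in> proj_tensor_body Q"
    if f: "\<forall>i. f i \<in> D i" and s: "\<bar>s\<bar> \<le> ?P" for s :: real and f :: "'l \<Rightarrow> 'n"
  proof -
    obtain k :: 'l where True by blast
    \<comment> \<open>The whole correction \<open>s / ?P\<close> goes into the single factor
      \<open>k\<close>. The coefficients then multiply to \<open>s\<close>, and none exceeds
      \<open>\<rho> i\<close> in absolute value.\<close>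
    define c where "c i = (if i = k then s / ?P else 1) * \<rho> i" for i
    have "(\<Prod>i\<in>UNIV. c i) = s / ?P * ?P"
      unfolding c_def prod.distrib by simp
    then have "(\<Prod>i\<in>UNIV. c i) = s" using P by (metis less_irrefl nonzero_eq_divide_eq)
    then have eq: "s *\<^sub>R axis f 1 = tensor (\<lambda>i. c i *\<^sub>R axis (f i) 1)"
      by (simp add: tensor_scaleR tensor_axis)
    have "\<bar>c i\<bar> \<le> \<rho> i" for i
    proof -
      have "\<bar>s / ?P\<bar> \<le> 1" using s P by simp
      then have "\<bar>if i = k then s / ?P else 1\<bar> * \<rho> i \<le> 1 * \<rho> i"
        using \<rho>(1)[of i] by (intro mult_right_mono) auto
      then show ?thesis using \<rho>(1)[of i] by (simp add: c_def abs_mult)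
    qed
    moreover have "axis (f i) 1 \<in> coord_space (D i)" for i
      using f by (auto simp: coord_space_def axis_def)
    ultimately have "c i *\<^sub>R axis (f i) 1 \<in> Q i" for i
      by (intro \<rho>(2)) (auto simp: norm_axis_1 subspace_scale subspace_coord_space)
    then have "tensor (\<lambda>i. c i *\<^sub>R axis (f i) 1) \<in> proj_tensor_body Q"
      by (rule tensor_in_proj_tensor_body)
    then show ?thesis by (simp only: eq)
  qed
  show ?thesis
  proof (rule that[of "?P / ?N"])
    show "0 < ?P / ?N" using P N by simp
    show "cball 0 (?P / ?N) \<inter> tensor_space D \<subseteq> proj_tensor_body Q"
    proof
      fix t assume t: "t \<in> cball 0 (?P / ?N) \<inter> tensor_space D"
      have "(?N * t $ f) *\<^sub>R axis f 1 \<in> proj_tensor_body Q" for f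
      proof (cases "\<forall>i. f i \<in> D i")
        case True
        have "\<bar>t $ f\<bar> \<le> ?P / ?N"
          using t component_le_norm_cart[of t f] by simp
        then have "\<bar>?N * t $ f\<bar> \<le> ?P" using N by (simp add: abs_mult field_simps)
        then show ?thesis using gen True by blast
      next
        case False
        then have "t $ f = 0" using t by (auto simp: tensor_space_def coord_space_def)
        then show ?thesis using 0 by simp
      qed
      \<comment> \<open>Equal weights \<open>1 / ?N\<close> make this a convex combination;
        multi-indices outside \<open>D\<close> contribute 0.\<close>
      then have "(\<Sum>f\<in>UNIV. (1 / ?N) *\<^sub>R (?N * t $ f) *\<^sub>R axis f 1) \<in> proj_tensor_body Q"
        using N by (intro convex_sum) (auto simp: proj_tensor_body_def convex_convex_hull)
      moreover have "(\<Sum>f\<in>UNIV. (1 / ?N) *\<^sub>R (?N * t $ f) *\<^sub>R axis f 1) = t"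
        using basis_expansion[of t] N by (simp add: scalar_mult_eq_scaleR)
      ultimately show "t \<in> proj_tensor_body Q" by simp
    qed
  qed
qed

lemma inj_tensor_body_sym_convex_body:
  assumes Q: "\<And>i. Q i \<in> sym_convex_bodies (coord_space (D i))"
  shows "inj_tensor_body D Q \<in> sym_convex_bodies (tensor_space D)"
proof -
  let ?Q = "\<lambda>i. polar_in (coord_space (D i)) (Q i)"
  have *: "?Q i \<in> sym_convex_bodies (coord_space (D i))" for i
    using Q by (intro polar_sym_convex_body subspace_coord_space)
  then obtain r where "0 < r" "cball 0 r \<inter> tensor_space D \<subseteq> proj_tensor_body ?Q"
    using proj_tensor_body_contains_ball[of ?Q D] by blast
  moreover have "bounded (proj_tensor_body ?Q)"
    using * by (intro bounded_proj_tensor_body) (auto simp: sym_convex_bodies_def compact_imp_bounded)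
  ultimately show ?thesis
    unfolding inj_tensor_body_def by (intro polar_in_sym_convex_bodies subspace_tensor_space)
qed

text \<open>The strip of all \<open>z\<close> with \<open>\<bar>z \<bullet> t\<bar> \<le> 1\<close>
  is convex, so the polar condition on the convex hull only has to be tested on elementary
  tensors.\<close>

lemma mem_inj_tensor_body:
  "t \<in> inj_tensor_body D Q \<longleftrightarrow> t \<in> tensor_space D \<and>
     (\<forall>y. (\<forall>i. y i \<in> polar_in (coord_space (D i)) (Q i)) \<longrightarrow> \<bar>tensor y \<bullet> t\<bar> \<le> 1)"
    (is "_ \<longleftrightarrow> _ \<and> ?R")
proof -
  let ?G = "{tensor y |y. \<forall>i. y i \<in> polar_in (coord_space (D i)) (Q i)}"
  have "convex {z. \<bar>z \<bullet> t\<bar> \<le> 1}"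
  proof -
    have "{z. \<bar>z \<bullet> t\<bar> \<le> 1} = {z. t \<bullet> z \<le> 1} \<inter> {z. t \<bullet> z \<ge> - 1}"
      by (auto simp: inner_commute)
    then show ?thesis by (simp add: convex_Int convex_halfspace_le convex_halfspace_ge)
  qed
  then have "convex hull ?G \<subseteq> {z. \<bar>z \<bullet> t\<bar> \<le> 1} \<longleftrightarrow> ?G \<subseteq> {z. \<bar>z \<bullet> t\<bar> \<le> 1}"
    by (meson hull_minimal hull_subset order.trans)
  then show ?thesis
    unfolding inj_tensor_body_def proj_tensor_body_def mem_polar_in by blast
qed

subsection \<open>Limits of tensorial bodies\<close>

text \<open>All members lie in the compact set \<open>inj_tensor_body D Q\<close>, so
  \<open>Blaschke_selection\<close> applies. What remains is that the limit set is again a tensorial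
  body for the same factors.\<close>

lemma compact_tensorial_bodies_wrt:
  assumes Q: "\<And>i. Q i \<in> sym_convex_bodies (coord_space (D i))"
  shows "compactin (hausdorff_topology (tensor_space D)) (tensorial_bodies_wrt D Q)"
proof -
  let ?E = "tensor_space D" and ?S = "tensorial_bodies_wrt D Q"
  note E = subspace_tensor_space[of D]
  interpret H: Metric_space "sym_convex_bodies ?E" "hausdorff_dist ?E"
    by (rule Metric_space_hausdorff_dist[OF E])
  have "compact (inj_tensor_body D Q)"
    using inj_tensor_body_sym_convex_body[of Q D, OF Q] by (simp add: sym_convex_bodies_def)
  have "\<exists>L r. L \<in> ?S \<and> strict_mono r \<and> limitin H.mtopology (F \<circ> r) L sequentially"
    if F: "range F \<subseteq> ?S" for F :: "nat \<Rightarrow> _"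
  proof -
    have FS: "F n \<in> ?S" for n using F by blast
    then have FB: "F n \<in> sym_convex_bodies ?E" for n by (simp add: tensorial_bodies_wrt_def)
    have Fp: "compact (F n)" "convex (F n)" "\<forall>x\<in>F n. - x \<in> F n" for n
      using FB[of n] unfolding sym_convex_bodies_iff_ball[OF E] by blast+
    have Fc: "compact (F n)" "F n \<noteq> {}" "F n \<subseteq> inj_tensor_body D Q" for n
      using FB[of n] FS[of n] sym_convex_bodies_nonempty[OF FB]
      by (auto simp: tensorial_bodies_wrt_def sym_convex_bodies_def)
    obtain L r where r: "strict_mono (r :: nat \<Rightarrow> nat)" and L: "compact L" "L \<subseteq> inj_tensor_body D Q"
      and lim: "\<And>e. 0 < e \<Longrightarrow> \<forall>\<^sub>F n in sequentially.
       (\<forall>x\<in>F (r n). \<exists>y\<in>L. dist x y \<le> e) \<and> (\<forall>y\<in>L. \<exists>x\<in>F (r n). dist y x \<le> e)"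
      by (rule Blaschke_selection[OF \<open>compact (inj_tensor_body D Q)\<close> Fc]) (rule that, assumption+)
    have appr: "\<exists>n. (\<forall>x\<in>F n. \<exists>y\<in>L. dist x y \<le> e) \<and> (\<forall>y\<in>L. \<exists>x\<in>F n. dist y x \<le> e)"
      if "0 < e" for e
      using lim[OF that] eventually_happens by force
    \<comment> \<open>A criterion that transfers properties to the limit: \<open>z\<close> belongs
      to \<open>L\<close> if each \<open>F n\<close> approximates \<open>z\<close> as well as it
      approximates all of \<open>L\<close>. Going from \<open>z\<close> to \<open>F n\<close> and
      back to \<open>L\<close> costs two errors \<open>e/3\<close>, and \<open>L\<close> is
      closed.\<close>
    have inL: "z \<in> L" if *: "\<And>e n. 0 < e \<Longrightarrow> (\<forall>y\<in>L. \<exists>x\<in>F n. dist y x \<le> e) \<Longrightarrow> \<exists>w\<in>F n. dist z w \<le> e" for z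
    proof -
      have "\<exists>y\<in>L. dist y z < e" if e: "0 < e" for e
      proof -
        obtain n where n: "\<forall>x\<in>F n. \<exists>y\<in>L. dist x y \<le> e/3" "\<forall>y\<in>L. \<exists>x\<in>F n. dist y x \<le> e/3"
          using appr[of "e/3"] e by auto
        then obtain w where w: "w \<in> F n" "dist z w \<le> e/3" using *[of "e/3" n] e by auto
        then obtain y where "y \<in> L" "dist w y \<le> e/3" using n by blast
        moreover have "dist y z < e"
          using dist_triangle[of z y w] w calculation e by (simp add: dist_commute)
        ultimately show ?thesis by blast
      qed
      then show ?thesis using L(1) by (metis closed_approachable compact_imp_closed)
    qed
    have "L \<in> ?S"
    proof -
      have P: "proj_tensor_body Q \<subseteq> L"
      proof
        fix p assume "p \<in> proj_tensor_body Q"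
        then have "p \<in> F n" for n using FS[of n] by (auto simp: tensorial_bodies_wrt_def)
        then show "p \<in> L" by (intro inL) (auto intro!: bexI[of _ p])
      qed
      have "convex L"
      proof (rule convexI)
        fix x y and u v :: real assume a: "x \<in> L" "y \<in> L" "0 \<le> u" "0 \<le> v" "u + v = 1"
        show "u *\<^sub>R x + v *\<^sub>R y \<in> L"
        proof (rule inL)
          fix e n assume e: "0 < (e::real)" "\<forall>y\<in>L. \<exists>x\<in>F n. dist y x \<le> e"
          obtain x' y' where xy: "x' \<in> F n" "y' \<in> F n" "dist x x' \<le> e" "dist y y' \<le> e"
            using e a by meson
          have "convex (F n)" using Fp by blast
          then have "u *\<^sub>R x' + v *\<^sub>R y' \<in> F n" using xy a by (auto intro: convexD)
          moreover have "dist (u *\<^sub>R x + v *\<^sub>R y) (u *\<^sub>R x' + v *\<^sub>R y') \<le> e"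
          proof -
            have "dist (u *\<^sub>R x + v *\<^sub>R y) (u *\<^sub>R x' + v *\<^sub>R y') = norm (u *\<^sub>R (x - x') + v *\<^sub>R (y - y'))"
              by (simp add: dist_norm algebra_simps)
            also have "\<dots> \<le> u * norm (x - x') + v * norm (y - y')"
              using a norm_triangle_ineq[of "u *\<^sub>R (x - x')" "v *\<^sub>R (y - y')"] by simp
            also have "\<dots> \<le> u * e + v * e"
              using a xy by (intro add_mono mult_left_mono) (auto simp: dist_norm)
            also have "\<dots> = e" using a by (simp flip: distrib_right)
            finally show ?thesis .
          qed
          ultimately show "\<exists>w\<in>F n. dist (u *\<^sub>R x + v *\<^sub>R y) w \<le> e" by blast
        qed
      qed
      moreover have "- x \<in> L" if x: "x \<in> L" for x
      proof (rule inL)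
        fix e n assume e: "0 < (e::real)" "\<forall>y\<in>L. \<exists>x\<in>F n. dist y x \<le> e"
        then obtain x' where "x' \<in> F n" "dist x x' \<le> e" using x by blast
        moreover have "- x' \<in> F n" using Fp[of n] calculation(1) by blast
        moreover have "dist (- x) (- x') = dist x x'"
          by (metis dist_minus)
        ultimately show "\<exists>w\<in>F n. dist (- x) w \<le> e" by force
      qed
      moreover have "\<exists>r>0. cball 0 r \<inter> ?E \<subseteq> L"
        using proj_tensor_body_contains_ball[of Q D, OF Q] order.trans[OF _ P] by metis
      moreover have "L \<subseteq> ?E" using L(2) by (auto simp: mem_inj_tensor_body)
      ultimately have "L \<in> sym_convex_bodies ?E"
        using L(1) unfolding sym_convex_bodies_iff_ball[OF E] by blast
      then show ?thesis using P L(2) by (simp add: tensorial_bodies_wrt_def)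
    qed
    moreover have "limitin H.mtopology (F \<circ> r) L sequentially"
    proof -
      have LM: "L \<in> sym_convex_bodies ?E" using \<open>L \<in> ?S\<close> by (simp add: tensorial_bodies_wrt_def)
      have "\<forall>\<^sub>F n in sequentially. hausdorff_dist ?E (F (r n)) L < e" if e: "0 < e" for e
      proof -
        have "0 < e / 2" using e by simp
        from lim[OF this] show ?thesis
        proof (rule eventually_mono)
          fix n assume "(\<forall>x\<in>F (r n). \<exists>y\<in>L. dist x y \<le> e/2) \<and> (\<forall>y\<in>L. \<exists>x\<in>F (r n). dist y x \<le> e/2)"
          then have "hausdorff_dist ?E (F (r n)) L \<le> e/2"
            using FB LM e by (intro hausdorff_dist_le[OF E]) (auto simp: sym_convex_bodies_def)
          then show "hausdorff_dist ?E (F (r n)) L < e" using e by simp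
        qed
      qed
      then show ?thesis using LM FB by (simp add: H.limitin_metric)
    qed
    ultimately show ?thesis using r by blast
  qed
  then show ?thesis
    unfolding hausdorff_topology_def H.compactin_sequentially
    by (auto simp: tensorial_bodies_wrt_def)
qed

text \<open>The lower bound survives because each \<open>p\<close> is the combination of
  \<open>p\<close> with itself, the upper one because the injective product is convex. Nonempty
  interior follows from the lower bound, uniformly in \<open>t\<close>.\<close>

lemma minkowski_convex_tensorial_bodies_wrt:
  assumes Q: "\<And>i. Q i \<in> sym_convex_bodies (coord_space (D i))"
  shows "minkowski_convex (tensorial_bodies_wrt D Q)"
  unfolding minkowski_convex_def
proof (intro ballI)
  fix A B and t :: real
  assume A: "A \<in> tensorial_bodies_wrt D Q" and B: "B \<in> tensorial_bodies_wrt D Q" and t: "t \<in> {0..1}"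
  let ?E = "tensor_space D" and ?C = "(*\<^sub>R) t ` A + (*\<^sub>R) (1 - t) ` B"
  note E = subspace_tensor_space[of D]
  note AB = A[unfolded tensorial_bodies_wrt_def sym_convex_bodies_iff_ball[OF E], simplified]
    B[unfolded tensorial_bodies_wrt_def sym_convex_bodies_iff_ball[OF E], simplified]
  have C: "z \<in> ?C \<longleftrightarrow> (\<exists>a\<in>A. \<exists>b\<in>B. z = t *\<^sub>R a + (1 - t) *\<^sub>R b)" for z
    by (auto simp: set_plus_def)
  have P: "proj_tensor_body Q \<subseteq> ?C"
  proof
    fix p assume "p \<in> proj_tensor_body Q"
    then have "p \<in> A" "p \<in> B" using AB by blast+
    moreover have "p = t *\<^sub>R p + (1 - t) *\<^sub>R p" by (simp add: algebra_simps)
    ultimately show "p \<in> ?C" unfolding C by blast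
  qed
  have I: "?C \<subseteq> inj_tensor_body D Q"
  proof
    fix z assume "z \<in> ?C"
    then obtain a b where "a \<in> A" "b \<in> B" "z = t *\<^sub>R a + (1 - t) *\<^sub>R b" unfolding C by blast
    moreover from this have "a \<in> inj_tensor_body D Q" "b \<in> inj_tensor_body D Q" using AB by blast+
    moreover have "convex (inj_tensor_body D Q)"
      using inj_tensor_body_sym_convex_body[of Q D, OF Q] by (simp add: sym_convex_bodies_def)
    ultimately show "z \<in> inj_tensor_body D Q"
      using t convexD[of "inj_tensor_body D Q" a b t "1 - t"] by simp
  qed
  have "?C \<subseteq> ?E" using I by (auto simp: mem_inj_tensor_body)
  moreover have "compact ?C"
  proof -
    have "?C = {x + y |x y. x \<in> (*\<^sub>R) t ` A \<and> y \<in> (*\<^sub>R) (1 - t) ` B}"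
      unfolding set_plus_def by blast
    then show ?thesis using AB by (simp only: compact_sums compact_scaling)
  qed
  moreover have "convex ?C"
    using AB by (intro convex_set_plus convex_scaling) auto
  moreover have "\<forall>z\<in>?C. - z \<in> ?C"
  proof
    fix z assume "z \<in> ?C"
    then obtain a b where "a \<in> A" "b \<in> B" "z = t *\<^sub>R a + (1 - t) *\<^sub>R b" unfolding C by blast
    moreover from this have "- a \<in> A" "- b \<in> B" "- z = t *\<^sub>R (- a) + (1 - t) *\<^sub>R (- b)"
      using AB by auto
    ultimately show "- z \<in> ?C" unfolding C by blast
  qed
  moreover have "\<exists>r>0. cball 0 r \<inter> ?E \<subseteq> ?C"
    using proj_tensor_body_contains_ball[of Q D, OF Q] order.trans[OF _ P] by metis
  ultimately have "?C \<in> sym_convex_bodies ?E"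
    unfolding sym_convex_bodies_iff_ball[OF E] by blast
  then show "?C \<in> tensorial_bodies_wrt D Q"
    using P I by (simp add: tensorial_bodies_wrt_def)
qed

text \<open>This lemma and the next one say that the gauge of \<open>T\<close> is multiplicative on elementary tensors.\<close>

lemma prod_polar_gauge_le_imp_mem:
  fixes x :: "'l::finite \<Rightarrow> real ^ 'n::finite"
  assumes Q: "\<And>i. Q i \<in> sym_convex_bodies (coord_space (D i))"
    and T: "T \<in> tensorial_bodies_wrt D Q" and x: "\<And>i. x i \<in> coord_space (D i)"
    and s: "0 < s" "(\<Prod>i\<in>UNIV. polar_gauge (coord_space (D i)) (Q i) (x i)) \<le> s"
  shows "(1 / s) *\<^sub>R tensor x \<in> T"
proof -
  let ?q = "\<lambda>i. polar_gauge (coord_space (D i)) (Q i) (x i)"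
  have TB: "T \<in> sym_convex_bodies (tensor_space D)" using T by (simp add: tensorial_bodies_wrt_def)
  have "convex T" "0 \<in> T"
    using sym_convex_bodiesE[OF subspace_tensor_space TB] by metis+
  show ?thesis
  proof (cases "\<exists>i. x i = 0")
    case True
    then show ?thesis using tensor_eq_0 \<open>0 \<in> T\<close> by fastforce
  next
    case False
    have q: "0 < ?q i" for i
      using False x Q by (intro polar_gauge_pos subspace_coord_space) auto
    have P: "0 < prod ?q UNIV" using q by (intro prod_pos) auto
    \<comment> \<open>Each factor is normalised to lie in its \<open>Q i\<close>, so the tensor lies
      in the projective product. The scaling by \<open>prod ?q UNIV / s\<close>, at most 1, then
      stays in the convex set \<open>T\<close>.\<close>
    have "tensor (\<lambda>i. (1 / ?q i) *\<^sub>R x i) \<in> T"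
      using tensor_in_proj_tensor_body[of "\<lambda>i. (1 / ?q i) *\<^sub>R x i" Q] T False
        divide_polar_gauge_mem[OF subspace_coord_space Q x]
      by (auto simp: tensorial_bodies_wrt_def)
    then have "(prod ?q UNIV / s) *\<^sub>R tensor (\<lambda>i. (1 / ?q i) *\<^sub>R x i) \<in> T"
      using s P by (intro convex_scale_mem \<open>convex T\<close> \<open>0 \<in> T\<close>) (auto simp del: prod_zero_iff)
    moreover have "(prod ?q UNIV / s) *\<^sub>R tensor (\<lambda>i. (1 / ?q i) *\<^sub>R x i) = (1 / s) *\<^sub>R tensor x"
      unfolding tensor_scaleR prod_dividef using P by (simp del: prod_zero_iff)
    ultimately show ?thesis by simp
  qed
qed

lemma mem_imp_prod_polar_gauge_le:
  fixes x :: "'l::finite \<Rightarrow> real ^ 'n::finite"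
  assumes Q: "\<And>i. Q i \<in> sym_convex_bodies (coord_space (D i))"
    and T: "T \<in> tensorial_bodies_wrt D Q" and c: "c *\<^sub>R tensor x \<in> T"
  shows "c * (\<Prod>i\<in>UNIV. polar_gauge (coord_space (D i)) (Q i) (x i)) \<le> 1"
proof -
  have "\<forall>i. \<exists>y. y \<in> polar_in (coord_space (D i)) (Q i) \<and>
      polar_gauge (coord_space (D i)) (Q i) (x i) = x i \<bullet> y"
    using polar_gauge_attained[OF subspace_coord_space Q] by blast
  then obtain y where y: "\<And>i. y i \<in> polar_in (coord_space (D i)) (Q i)"
    "\<And>i. polar_gauge (coord_space (D i)) (Q i) (x i) = x i \<bullet> y i"
    by metis
  \<comment> \<open>The \<open>y i\<close> attain the gauges of the factors. Their tensor is one of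
    the tests defining the injective product, and its pairing with \<open>tensor x\<close> factors
    into the product of the gauges.\<close>
  have "\<bar>tensor y \<bullet> (c *\<^sub>R tensor x)\<bar> \<le> 1"
    using T c y(1) by (auto simp: tensorial_bodies_wrt_def mem_inj_tensor_body)
  then show ?thesis by (simp add: y(2) inner_tensor inner_commute[of "y _"])
qed

section \<open>Closedness: recovering the factors from slices\<close>

text \<open>Inserting \<open>x\<close> in place of \<open>a i\<close> is linear and multiplies the
  norm by the positive number \<open>m\<close>. The preimage of \<open>T\<close> therefore inherits
  closedness, convexity, symmetry, a bound and a ball.\<close>

lemma tensor_slice_sym_convex_body:
  fixes D :: "'l::finite \<Rightarrow> 'n::finite set"
  assumes T: "T \<in> sym_convex_bodies (tensor_space D)"
    and a: "\<And>i. a i \<in> coord_space (D i)" "\<And>i. a i \<noteq> 0"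
  defines "Q \<equiv> (\<lambda>i. {x \<in> coord_space (D i). tensor (a(i := x)) \<in> T})"
  shows "Q i \<in> sym_convex_bodies (coord_space (D i))"
proof -
  obtain r R where t: "T \<subseteq> tensor_space D" "compact T" "convex T" "\<And>x. x \<in> T \<Longrightarrow> - x \<in> T"
    "0 < r" "\<And>x. x \<in> tensor_space D \<Longrightarrow> norm x \<le> r \<Longrightarrow> x \<in> T" "\<And>x. x \<in> T \<Longrightarrow> norm x \<le> R"
    using sym_convex_bodiesE[OF subspace_tensor_space T] by metis
  let ?f = "\<lambda>x. tensor (a(i := x))"
  define m where "m = (\<Prod>k\<in>UNIV - {i}. norm (a k))"
  have m: "0 < m" unfolding m_def using a by (intro prod_pos) auto
  have nf: "norm (?f x) = m * norm x" for x
    by (simp add: norm_tensor prod.remove[of UNIV i] m_def)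
  have lin: "linear ?f" by (rule linear_tensor_fun_upd)
  have Qi: "Q i = coord_space (D i) \<inter> ?f -` T" by (auto simp: Q_def)
  have "closed (?f -` T)"
    using lin t(2) by (intro closed_vimage linear_continuous_on compact_imp_closed)
      (simp_all add: linear_conv_bounded_linear)
  then have "closed (Q i)" unfolding Qi
    by (rule closed_Int[OF closed_subspace[OF subspace_coord_space]])
  moreover have "bounded (Q i)"
  proof -
    have "norm x \<le> R / m" if "x \<in> Q i" for x
      using t(7)[of "?f x"] that m by (simp add: Qi nf field_simps)
    then show ?thesis by (auto simp: bounded_iff)
  qed
  ultimately have "compact (Q i)" by (simp add: compact_eq_bounded_closed)
  moreover have "convex (Q i)" unfolding Qi
    by (rule convex_Int[OF subspace_imp_convex[OF subspace_coord_space] convex_linear_vimage[OF lin t(3)]])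
  moreover have "\<forall>x\<in>Q i. - x \<in> Q i"
    using t(4) by (auto simp: Qi linear_neg[OF lin] subspace_neg subspace_coord_space)
  moreover have "cball 0 (r / m) \<inter> coord_space (D i) \<subseteq> Q i"
  proof
    fix x assume x: "x \<in> cball 0 (r / m) \<inter> coord_space (D i)"
    then have "?f x \<in> tensor_space D" using a by (intro tensor_in_tensor_space) auto
    moreover have "norm (?f x) \<le> r" using x m by (simp add: nf field_simps)
    ultimately show "x \<in> Q i" using t(6) x by (simp add: Qi)
  qed
  ultimately show ?thesis
    unfolding sym_convex_bodies_iff_ball[OF subspace_coord_space]
    using t(5) m by (auto simp: Q_def intro!: exI[of _ "r / m"])
qed

text \<open>The last two conclusions say that \<open>tensor a\<close> has gauge 1 for
  \<open>T\<close>. It is obtained by stretching an elementary tensor of axis vectors as far as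
  \<open>T\<close> allows.\<close>

lemma exists_boundary_tensor:
  fixes D :: "'l::finite \<Rightarrow> 'n::finite set"
  assumes T: "T \<in> sym_convex_bodies (tensor_space D)" and D: "\<And>i. D i \<noteq> {}"
  obtains a where "\<And>i. a i \<in> coord_space (D i)" "\<And>i. a i \<noteq> 0" "tensor a \<in> T"
    "\<And>c. c *\<^sub>R tensor a \<in> T \<Longrightarrow> c \<le> 1"
proof -
  obtain r R where t: "T \<subseteq> tensor_space D" "compact T" "convex T" "0 \<in> T"
    "0 < r" "\<And>x. x \<in> tensor_space D \<Longrightarrow> norm x \<le> r \<Longrightarrow> x \<in> T" "0 < R" "\<And>x. x \<in> T \<Longrightarrow> norm x \<le> R"
    using sym_convex_bodiesE[OF subspace_tensor_space T] by metis
  have "\<forall>i. \<exists>j. j \<in> D i" using D by auto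
  then obtain f where f: "\<And>i. f i \<in> D i" by metis
  let ?b = "\<lambda>i. axis (f i) 1 :: real ^ 'n"
  have b: "?b i \<in> coord_space (D i)" for i using f by (auto simp: coord_space_def axis_def)
  have nb: "norm (tensor ?b) = 1" by (simp add: norm_tensor norm_axis_1)
  define S where "S = {s. s *\<^sub>R tensor ?b \<in> T}"
  have "closed S" unfolding S_def
    using continuous_closed_vimage[OF compact_imp_closed[OF t(2)], of "\<lambda>s. s *\<^sub>R tensor ?b"]
    by (simp add: vimage_def)
  moreover have "bounded S"
    using t(8) nb by (fastforce simp: S_def bounded_iff)
  ultimately have "compact S" by (simp add: compact_eq_bounded_closed)
  have rS: "r \<in> S" unfolding S_def mem_Collect_eq
    using b t(5) nb by (intro t(6) subspace_scale subspace_tensor_space tensor_in_tensor_space) auto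
  then obtain s where s: "s \<in> S" "\<And>c. c \<in> S \<Longrightarrow> c \<le> s"
    using compact_attains_sup[OF \<open>compact S\<close>] by blast
  have s0: "0 < s" using s(2)[OF rS] t(5) by simp
  obtain k :: 'l where True by blast
  \<comment> \<open>The maximal factor \<open>s\<close> is put into one component; by multilinearity
    it scales the whole tensor.\<close>
  define a where "a = ?b(k := s *\<^sub>R ?b k)"
  have ta: "tensor a = s *\<^sub>R tensor ?b"
  proof -
    have "?b(k := axis (f k) 1) = ?b" by auto
    then show ?thesis by (simp only: a_def linear_scale[OF linear_tensor_fun_upd])
  qed
  show ?thesis
  proof (rule that)
    show "a i \<in> coord_space (D i)" for i using b by (simp add: a_def subspace_scale subspace_coord_space)
    show "a i \<noteq> 0" for i using s0 by (simp add: a_def)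
    show "tensor a \<in> T" using s(1) by (simp add: ta S_def)
    show "c \<le> 1" if "c *\<^sub>R tensor a \<in> T" for c
      using s(2)[of "c * s"] s0 that by (simp add: S_def ta)
  qed
qed

text \<open>The gauge of \<open>T'\<close> at \<open>tensor (a(i := x))\<close> is
  \<open>?q i x * n i\<close>, so up to a factor \<open>\<kappa>\<close> the slice
  \<open>Q i\<close> is \<open>Q' i\<close> divided by \<open>n i\<close>. The number
  \<open>m\<close>, the gauge of \<open>T'\<close> at \<open>tensor a\<close>, lies between
  \<open>1 / \<kappa>\<close> and \<open>\<kappa>\<close>, which controls the product of all
  \<open>n i\<close>. Counting the losses gives the exponent \<open>K\<close>.\<close>

lemma tensorial_bodies_near:
  fixes D :: "'l::finite \<Rightarrow> 'n::finite set"
  assumes T: "T \<in> sym_convex_bodies (tensor_space D)"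
    and a: "\<And>i. a i \<in> coord_space (D i)" "\<And>i. a i \<noteq> 0" "tensor a \<in> T"
      "\<And>c. c *\<^sub>R tensor a \<in> T \<Longrightarrow> c \<le> 1"
    and T': "T' \<in> tensorial_bodies D" and \<kappa>: "1 \<le> \<kappa>" "T \<subseteq> (*\<^sub>R) \<kappa> ` T'" "T' \<subseteq> (*\<^sub>R) \<kappa> ` T"
  defines "Q \<equiv> (\<lambda>i. {x \<in> coord_space (D i). tensor (a(i := x)) \<in> T})"
  defines "K \<equiv> 2 * CARD('l) + 2"
  shows "\<And>x. (\<And>i. x i \<in> Q i) \<Longrightarrow> (1 / \<kappa> ^ K) *\<^sub>R tensor x \<in> T"
    and "\<And>y t. (\<And>i. y i \<in> polar_in (coord_space (D i)) (Q i)) \<Longrightarrow> t \<in> T \<Longrightarrow> \<bar>tensor y \<bullet> t\<bar> \<le> \<kappa> ^ K"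
proof -
  obtain Q' where Q': "\<And>i. Q' i \<in> sym_convex_bodies (coord_space (D i))"
    and T'Q: "T' \<in> tensorial_bodies_wrt D Q'"
    using T' by (auto simp: tensorial_bodies_def)
  have \<kappa>0: "0 < \<kappa>" using \<kappa> by simp
  have down: "(1 / \<kappa>) *\<^sub>R t \<in> T'" if "t \<in> T" for t using \<kappa>(2) \<kappa>0 that by fastforce
  have up: "(1 / \<kappa>) *\<^sub>R t \<in> T" if "t \<in> T'" for t using \<kappa>(3) \<kappa>0 that by fastforce
  let ?q = "\<lambda>i. polar_gauge (coord_space (D i)) (Q' i)" and ?l = "CARD('l)"
  have q: "0 < ?q i (a i)" for i
    using a Q' by (intro polar_gauge_pos subspace_coord_space) auto
  have qn: "0 \<le> ?q i x" for i x using Q' by (intro polar_gauge_nonneg subspace_coord_space)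
  define m where "m = (\<Prod>i\<in>UNIV. ?q i (a i))"
  define n where "n i = (\<Prod>k\<in>UNIV - {i}. ?q k (a k))" for i
  have m0: "0 < m" and n0: "0 < n i" for i
    unfolding m_def n_def using q by (auto intro: prod_pos)
  have upd: "(\<Prod>k\<in>UNIV. ?q k ((a(i := x)) k)) = ?q i x * n i" for i x
    by (simp add: prod.remove[of UNIV i] n_def)
  have "?q i (a i) * n i = m" for i unfolding m_def n_def by (simp add: prod.remove[of UNIV i])
  then have "(\<Prod>i\<in>(UNIV::'l set). m) = (\<Prod>i\<in>UNIV. ?q i (a i) * n i)" by simp
  \<comment> \<open>Each gauge \<open>?q i (a i)\<close> is missing from exactly one of the
    \<open>n i\<close>, so the product of the \<open>n i\<close> is a power of \<open>m\<close> with
    exponent \<open>?l - 1\<close>; this form avoids the subtraction.\<close>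
  then have n_prod: "m ^ ?l = m * (\<Prod>i\<in>UNIV. n i)" by (simp add: prod.distrib m_def)
  have m_le: "m \<le> \<kappa>"
    using mem_imp_prod_polar_gauge_le[where Q = Q' and D = D, OF Q' T'Q down[OF a(3)]] \<kappa>0 by (simp add: m_def)
  have "(1 / m) *\<^sub>R tensor a \<in> T'"
    using a m0 by (intro prod_polar_gauge_le_imp_mem[where Q = Q' and D = D, OF Q' T'Q]) (auto simp: m_def)
  from up[OF this] have "1 / \<kappa> * (1 / m) \<le> 1" by (intro a(4)) simp
  then have m_ge: "1 \<le> \<kappa> * m" using \<kappa>0 m0 by (simp add: field_simps)
  show "(1 / \<kappa> ^ K) *\<^sub>R tensor x \<in> T" if x: "\<And>i. x i \<in> Q i" for x
  proof -
    have xE: "x i \<in> coord_space (D i)" for i using x by (simp add: Q_def)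
    have "?q i (x i) * n i \<le> \<kappa>" for i
      using mem_imp_prod_polar_gauge_le[where Q = Q' and D = D, OF Q' T'Q down, of "a(i := x i)"] x \<kappa>0
      unfolding upd by (simp add: Q_def)
    then have "(\<Prod>i\<in>UNIV. ?q i (x i) * n i) \<le> (\<Prod>i\<in>(UNIV::'l set). \<kappa>)"
      using qn n0 by (intro prod_mono) (auto simp: less_imp_le)
    then have le: "(\<Prod>i\<in>UNIV. ?q i (x i)) * (\<Prod>i\<in>UNIV. n i) \<le> \<kappa> ^ ?l" by (simp add: prod.distrib)
    let ?p = "\<Prod>i\<in>UNIV. ?q i (x i)"
    have p: "0 \<le> ?p" using qn by (simp add: prod_nonneg)
    \<comment> \<open>The factor \<open>(\<kappa> * m) ^ ?l\<close>, at least 1, is inserted because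
      \<open>m ^ ?l\<close> brings in the product of the \<open>n i\<close> that the bound
      \<open>le\<close> requires.\<close>
    have "?p \<le> ?p * (\<kappa> * m) ^ ?l"
      using p m_ge by (simp add: mult_le_cancel_left1 one_le_power)
    also have "\<dots> = \<kappa> ^ ?l * m * (?p * (\<Prod>i\<in>UNIV. n i))"
      by (simp add: power_mult_distrib n_prod)
    also have "\<dots> \<le> \<kappa> ^ ?l * \<kappa> * \<kappa> ^ ?l"
    proof (rule mult_mono[OF _ le])
      show "\<kappa> ^ ?l * m \<le> \<kappa> ^ ?l * \<kappa>" using m_le \<kappa>0 by simp
      show "0 \<le> ?p * (\<Prod>i\<in>UNIV. n i)"
        using qn n0 by (intro mult_nonneg_nonneg prod_nonneg) (auto simp: less_imp_le)
    qed (use \<kappa>0 in simp)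
    also have "\<dots> = \<kappa> ^ (2 * ?l + 1)" by (simp add: power_add mult_2)
    finally have "(1 / \<kappa> ^ (2 * ?l + 1)) *\<^sub>R tensor x \<in> T'"
      using xE \<kappa>0 by (intro prod_polar_gauge_le_imp_mem[where Q = Q' and D = D, OF Q' T'Q]) auto
    from up[OF this] show ?thesis by (simp add: K_def)
  qed
  show "\<bar>tensor y \<bullet> t\<bar> \<le> \<kappa> ^ K"
    if y: "\<And>i. y i \<in> polar_in (coord_space (D i)) (Q i)" and t: "t \<in> T" for y t
  proof -
    \<comment> \<open>Polarity reverses inclusions: \<open>Q' i\<close> scaled by
      \<open>1 / (\<kappa> * n i)\<close> lies in \<open>Q i\<close>, so the same scaling sends the
      polar of \<open>Q i\<close> into the polar of \<open>Q' i\<close>.\<close>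
    have y': "(1 / (\<kappa> * n i)) *\<^sub>R y i \<in> polar_in (coord_space (D i)) (Q' i)" for i
      unfolding mem_polar_in
    proof (intro conjI ballI)
      show "(1 / (\<kappa> * n i)) *\<^sub>R y i \<in> coord_space (D i)"
        using y by (simp add: mem_polar_in subspace_scale subspace_coord_space)
      fix x assume x: "x \<in> Q' i"
      then have xE: "x \<in> coord_space (D i)" using Q'[of i] by (auto simp: sym_convex_bodies_def)
      then have "?q i x \<le> 1" using x Q' polar_gauge_le_1_iff[OF subspace_coord_space] by blast
      then have "?q i x * n i \<le> n i" using n0[of i] by simp
      then have "(1 / n i) *\<^sub>R tensor (a(i := x)) \<in> T'"
        using a xE n0 unfolding upd[symmetric]
        by (intro prod_polar_gauge_le_imp_mem[where Q = Q' and D = D, OF Q' T'Q]) auto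
      from up[OF this] have "tensor (a(i := (1 / (\<kappa> * n i)) *\<^sub>R x)) \<in> T"
        by (simp add: linear_scale[OF linear_tensor_fun_upd])
      then have "(1 / (\<kappa> * n i)) *\<^sub>R x \<in> Q i"
        using xE by (simp add: Q_def subspace_scale subspace_coord_space)
      then have "\<bar>((1 / (\<kappa> * n i)) *\<^sub>R x) \<bullet> y i\<bar> \<le> 1" using y unfolding mem_polar_in by blast
      then show "\<bar>x \<bullet> ((1 / (\<kappa> * n i)) *\<^sub>R y i)\<bar> \<le> 1" by simp
    qed
    define N where "N = (\<Prod>i\<in>UNIV. n i)"
    have N0: "0 < N" using n0 by (simp add: N_def prod_pos)
    have eq: "tensor (\<lambda>i. (1 / (\<kappa> * n i)) *\<^sub>R y i) = (1 / (\<kappa> ^ ?l * N)) *\<^sub>R tensor y"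
      unfolding tensor_scaleR by (simp add: prod_dividef prod.distrib N_def)
    have "(1 / \<kappa>) *\<^sub>R t \<in> inj_tensor_body D Q'"
      using T'Q down[OF t] by (auto simp: tensorial_bodies_wrt_def)
    then have "\<bar>tensor (\<lambda>i. (1 / (\<kappa> * n i)) *\<^sub>R y i) \<bullet> ((1 / \<kappa>) *\<^sub>R t)\<bar> \<le> 1"
      using y' by (simp only: mem_inj_tensor_body simp_thms)
    then have "\<bar>((1 / (\<kappa> ^ ?l * N)) *\<^sub>R tensor y) \<bullet> ((1 / \<kappa>) *\<^sub>R t)\<bar> \<le> 1"
      by (simp only: eq)
    then have "\<bar>tensor y \<bullet> t\<bar> \<le> \<kappa> * (\<kappa> ^ ?l * N)"
      using \<kappa>0 N0 by (simp add: abs_mult field_simps)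
    also have "N \<le> \<kappa> ^ (?l + 1)"
    proof -
      \<comment> \<open>Multiplying by \<open>\<kappa> * m\<close>, at least 1, supplies the missing
        \<open>m\<close> that completes \<open>N\<close> to \<open>m ^ ?l\<close>.\<close>
      have "N \<le> \<kappa> * m * N" using m_ge N0 by simp
      also have "\<dots> = \<kappa> * m ^ ?l" by (simp add: n_prod N_def)
      also have "\<dots> \<le> \<kappa> * \<kappa> ^ ?l" using m_le m0 \<kappa>0 by (intro mult_left_mono power_mono) auto
      finally show ?thesis by simp
    qed
    then have "\<kappa> * (\<kappa> ^ ?l * N) \<le> \<kappa> * (\<kappa> ^ ?l * \<kappa> ^ (?l + 1))"
      using \<kappa>0 by (intro mult_left_mono) auto
    also have "\<dots> = \<kappa> ^ K" by (simp add: K_def power_add mult_2)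
    finally show ?thesis .
  qed
qed

text \<open>The tensor \<open>a\<close> and the slices \<open>Q\<close> depend on \<open>T\<close>
  alone, so one choice of factors serves all approximating bodies. Both estimates of
  \<open>tensorial_bodies_near\<close> are closed conditions, and their constants tend to 1.\<close>

lemma tensorial_bodies_dilation_closed:
  fixes D :: "'l::finite \<Rightarrow> 'n::finite set"
  assumes T: "T \<in> sym_convex_bodies (tensor_space D)" and D: "\<And>i. D i \<noteq> {}"
    and near: "\<And>e. 0 < e \<Longrightarrow> \<exists>T'\<in>tensorial_bodies D. T \<subseteq> (*\<^sub>R) (1 + e) ` T' \<and> T' \<subseteq> (*\<^sub>R) (1 + e) ` T"
  shows "T \<in> tensorial_bodies D"
proof -
  obtain a where a: "\<And>i. a i \<in> coord_space (D i)" "\<And>i. a i \<noteq> 0" "tensor a \<in> T"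
      "\<And>c. c *\<^sub>R tensor a \<in> T \<Longrightarrow> c \<le> 1"
    using exists_boundary_tensor[OF T D] by blast
  define Q where "Q = (\<lambda>i. {x \<in> coord_space (D i). tensor (a(i := x)) \<in> T})"
  define K where "K = 2 * CARD('l) + 2"
  have TE: "T \<subseteq> tensor_space D" "closed T" "convex T"
    using T by (auto simp: sym_convex_bodies_def compact_imp_closed)
  have QB: "\<And>i. Q i \<in> sym_convex_bodies (coord_space (D i))"
    unfolding Q_def by (rule tensor_slice_sym_convex_body[OF T a(1,2)])
  define \<kappa> where "\<kappa> = (\<lambda>n. 1 + 1 / real (Suc n))"
  have "\<kappa> \<longlonglongrightarrow> 1 + 0" unfolding \<kappa>_def
    by (intro tendsto_add tendsto_const LIMSEQ_Suc[OF lim_const_over_n])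
  then have lim: "(\<lambda>n. \<kappa> n ^ K) \<longlonglongrightarrow> 1"
    using tendsto_power[of \<kappa> 1 _ K] by simp
  have near': "\<exists>T'\<in>tensorial_bodies D. 1 \<le> \<kappa> n \<and> T \<subseteq> (*\<^sub>R) (\<kappa> n) ` T' \<and> T' \<subseteq> (*\<^sub>R) (\<kappa> n) ` T" for n
    using near[of "1 / real (Suc n)"] by (simp add: \<kappa>_def)
  have P: "(1 / \<kappa> n ^ K) *\<^sub>R tensor x \<in> T" if "\<And>i. x i \<in> Q i" for x n
    using tensorial_bodies_near(1)[OF T a] near'[of n] that unfolding Q_def K_def by blast
  have I: "\<bar>tensor y \<bullet> t\<bar> \<le> \<kappa> n ^ K"
    if "\<And>i. y i \<in> polar_in (coord_space (D i)) (Q i)" "t \<in> T" for y t n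
    using tensorial_bodies_near(2)[OF T a] near'[of n] that unfolding Q_def K_def by blast
  have "tensor x \<in> T" if "\<forall>i. x i \<in> Q i" for x
  proof (rule closed_sequentially[OF TE(2)])
    show "(1 / \<kappa> n ^ K) *\<^sub>R tensor x \<in> T" for n using P that by blast
    show "(\<lambda>n. (1 / \<kappa> n ^ K) *\<^sub>R tensor x) \<longlonglongrightarrow> tensor x"
      using tendsto_scaleR[OF tendsto_divide[OF tendsto_const lim, of 1] tendsto_const, of "tensor x"]
      by simp
  qed
  then have "proj_tensor_body Q \<subseteq> T"
    unfolding proj_tensor_body_def using TE by (intro hull_minimal) auto
  moreover have "T \<subseteq> inj_tensor_body D Q"
    using TE(1) I LIMSEQ_le_const[OF lim] unfolding mem_inj_tensor_body subset_iff by blast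
  ultimately show ?thesis
    using T QB by (auto simp: tensorial_bodies_def tensorial_bodies_wrt_def)
qed

text \<open>If every metric ball about \<open>T\<close> met the tensorial bodies,
  \<open>hausdorff_near_imp_dilate\<close> would provide tensorial bodies sandwiching
  \<open>T\<close> up to dilations arbitrarily close to 1.\<close>

lemma closed_tensorial_bodies:
  fixes D :: "'l::finite \<Rightarrow> 'n::finite set"
  assumes D: "\<And>i. D i \<noteq> {}"
  shows "closedin (hausdorff_topology (tensor_space D)) (tensorial_bodies D)"
proof -
  let ?E = "tensor_space D"
  note E = subspace_tensor_space[of D]
  interpret H: Metric_space "sym_convex_bodies ?E" "hausdorff_dist ?E"
    by (rule Metric_space_hausdorff_dist[OF E])
  have sub: "tensorial_bodies D \<subseteq> sym_convex_bodies ?E"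
    by (auto simp: tensorial_bodies_def tensorial_bodies_wrt_def)
  have "\<exists>r>0. disjnt (tensorial_bodies D) (H.mball T r)"
    if T: "T \<in> sym_convex_bodies ?E - tensorial_bodies D" for T
  proof (rule ccontr)
    assume "\<not> ?thesis"
    then have near: "\<exists>T'\<in>tensorial_bodies D. hausdorff_dist ?E T T' < \<delta>" if "0 < \<delta>" for \<delta>
      using that unfolding disjnt_iff H.in_mball by blast
    have "\<exists>T'\<in>tensorial_bodies D. T \<subseteq> (*\<^sub>R) (1 + e) ` T' \<and> T' \<subseteq> (*\<^sub>R) (1 + e) ` T"
      if e: "0 < e" for e
    proof -
      obtain \<delta> where \<delta>: "0 < \<delta>" "\<And>T'. T' \<in> sym_convex_bodies ?E \<Longrightarrow> hausdorff_dist ?E T T' < \<delta> \<Longrightarrow>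
          T \<subseteq> (*\<^sub>R) (1 + e) ` T' \<and> T' \<subseteq> (*\<^sub>R) (1 + e) ` T"
        using hausdorff_near_imp_dilate[OF E DiffD1[OF T] e] by blast
      then show ?thesis using near[OF \<delta>(1)] sub by blast
    qed
    then show False using tensorial_bodies_dilation_closed[OF DiffD1[OF T] D] T by blast
  qed
  then show ?thesis unfolding hausdorff_topology_def H.closedin_metric using sub by blast
qed

theorem proposition3p4:
  fixes d :: "'l::finite \<Rightarrow> nat" and D :: "'l \<Rightarrow> 'n::finite set"
  assumes "CARD('l) \<ge> 2"
    and "\<And>i. d i \<ge> 2"
    and "\<And>i. card (D i) = d i"
  shows "(\<forall>Q. (\<forall>i. Q i \<in> sym_convex_bodies (coord_space (D i))) \<longrightarrow>
            compactin (hausdorff_topology (tensor_space D)) (tensorial_bodies_wrt D Q) \<and>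
            minkowski_convex (tensorial_bodies_wrt D Q)) \<and>
         closedin (hausdorff_topology (tensor_space D)) (tensorial_bodies D)"
proof -
  \<comment> \<open>Positive dimension gives each factor an axis vector, from which the boundary
    tensor is built.\<close>
  have "D i \<noteq> {}" for i using assms(2,3)[of i] by auto
  then show ?thesis
    using compact_tensorial_bodies_wrt minkowski_convex_tensorial_bodies_wrt closed_tensorial_bodies
    by blast
qed

end
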